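(* Let $\mathbb{C}=\{C(t),t\ge 0\}$ be the stationary Markov process of the open network of queues described in the context, with states $C=(c_1,\ldots,c_J)$ and defined by the transition rates (A), (B), (C) given there. Then its equilibrium distribution is $$\pi(C)=\prod_{j=1}^{J}\pi_j(c_j),\qquad\text{where}\qquad \pi_j(c_j)=B_j\prod_{l=1}^{n_j}\frac{\alpha_j\big(t_j(l),s_j(l)\big)}{\mu_j(l)},$$ $$B_j^{-1}=\sum_{n=0}^{\infty}\frac{b_j^{\,n}}{\prod_{l=1}^{n}\mu_j(l)},\qquad b_j=\sum_{i=1}^{I}\sum_{s=1}^{f(i)}\alpha_j(i,s),$$ and $$\alpha_j(i,s)=\begin{cases} v(i), & \text{if } r(i,s)=j,\\ 0, & \text{in other cases.}\end{cases}$$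
   Context: Open network of queues with several customer types. There are $J<\infty$ nodes; node $j$ has waiting capacity $L_j<\infty$, $j=1,\ldots,J$. There are $I<\infty$ customer types, and the path of a customer is fixed by its type: a type $i$ customer follows the path $r(i,1),r(i,2),\ldots,r(i,f(i))$, where $r(i,s)$ is the $s$-th node visited by type $i$ customers and $r(i,f(i))$ is the last one before leaving the network. The type of a customer does not change during its sojourn in the network. Type $i$ customers arrive at the network from outside according to a Poisson process with parameter $v(i)$, $i=1,\ldots,I$. At the nodes, customers have exponentially distributed service requirements; with no loss of generality the mean service requirement is supposed unitary. All service requirements of all customers at all nodes are mutually independent and independent of the arrival processes. If there are $n_j$ customers at node $j$, they are in positions $1,\ldots,n_j$, and: - the expected service requirement for the customer in position $l$ is $\mu_j^{-1}(l)$, $l=1,\ldots,n_j$, with $\mu_j(l)>0$ if $n_j>0$; - the service velocity given to the customer in position $l$ is $\gamma_j(n_j,l)$, which depends on $n_j$, with $\sum_l\gamma_j(n_j,l)=1$; - when the customer in position $l$ leaves the node, the customers in positions $l+1,\ldots,n_j$ move to positions $l,\ldots,n_j-1$ respectively; - a customer arriving at node $j$ occupies position $l$ with probability $\delta_j(n_j+1,l)$, and the customers that were in positions $l,\ldots,n_j$ move to positions $l+1,\ldots,n_j+1$ respectively; $\sum_l\delta_j(n_j,l)=1$. State: $t_j(l)$ is the type of the customer in position $l$ at node $j$, and $s_j(l)$ is the stage of its path it has reached when at node $j$. Put $c_j(l)=(t_j(l),s_j(l))$, $c_j=(c_j(1),\ldots,c_j(n_j))$, $C=(c_1,\ldots,c_J)$;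 $C(t)=C$ means that the network is in state $C$ at instant $t$. The process $\mathbb{C}=\{C(t),t\ge0\}$ is a continuous-time Markov chain with countable state space. Its possible transitions are of three kinds: - $T_{jlr}C$ is the state after the customer in position $l$ at node $j$ moves to position $r$ in the next node of its path, with its stage becoming $s_j(l)+1$ (the next node may be $j$ itself: feedback); - $T_{jl\cdot}C$ is the state after a type $i$ customer in position $l$ at node $j=r(i,f(i))$, the last node of its path, leaves the network; - $T^{ir}C$ is the state after a type $i$ customer enters the network from outside, occupying position $r$ at node $r(i,1)$. Transition rates: (A) $q(C,T_{jlr}C)=\sum_g\sum_h\mu_j(g)\gamma_j(n_j,g)\delta_k(n_k+1,h)$ if the next node is $k\ne j$, and $q(C,T_{jlr}C)=\sum_g\sum_h\mu_j(g)\gamma_j(n_j,g)\delta_j(n_j,h)$ if the next node is $j$; the double sum is over all $g,h$ such that $T_{jlr}C=T_{jgh}C$. (B) $q(C,T_{jl\cdot}C)=\sum_g\mu_j(g)\gamma_j(n_j,g)$, the sum being over all $g$ for which $T_{jl\cdot}C=T_{jg\cdot}C$. (C) $q(C,T^{ir}C)=\sum_h v(i)\,\delta_k(n_k+1,h)$ with $k=r(i,1)$, the sum being over all $h$ for which $T^{ir}C=T^{ih}C$.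
   Formalization: Assumes in addition that the total service rate at node j with n≥1 customers, the sum over l of μ_j(l)γ_j(n,l), equals μ_j(n), without which the claim fails (e.g. FIFO with μ(l)=l); waiting capacities L_j are dropped, as the rates and the infinite series for B_j ignore them. *)

theory Defs
  imports "HOL-Probability.Probability"
begin

definition transition_function :: "'s set \<Rightarrow> (real \<Rightarrow> 's \<Rightarrow> 's \<Rightarrow> real) \<Rightarrow> bool" where
  "transition_function S P \<longleftrightarrow>
     (\<forall>t\<ge>0. \<forall>x\<in>S. (\<forall>y\<in>S. 0 \<le> P t x y) \<and> (P t x has_sum 1) S) \<and>
     (\<forall>x\<in>S. \<forall>y\<in>S. P 0 x y = of_bool (x = y)) \<and>
     (\<forall>s\<ge>0. \<forall>t\<ge>0. \<forall>x\<in>S. \<forall>z\<in>S. ((\<lambda>y. P s x y * P t y z) has_sum P (s + t) x z) S)"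

text \<open>Only the values \<open>q x y\<close> with \<open>x \<noteq> y\<close> matter: the rate of leaving \<open>x\<close> is
  \<open>\<Sum>y\<noteq>x. q x y\<close> (the chain is conservative).\<close>

definition has_transition_rates ::
    "'s set \<Rightarrow> (real \<Rightarrow> 's \<Rightarrow> 's \<Rightarrow> real) \<Rightarrow> ('s \<Rightarrow> 's \<Rightarrow> real) \<Rightarrow> bool" where
  "has_transition_rates S P q \<longleftrightarrow>
     (\<forall>x\<in>S. \<forall>y\<in>S. x \<noteq> y \<longrightarrow> ((\<lambda>h. P h x y / h) \<longlongrightarrow> q x y) (at_right 0)) \<and>
     (\<forall>x\<in>S. q x summable_on (S - {x}) \<and>
        ((\<lambda>h. (1 - P h x x) / h) \<longlongrightarrow> (\<Sum>\<^sub>\<infinity>y\<in>S - {x}. q x y)) (at_right 0))"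

definition markov_chain ::
    "'w measure \<Rightarrow> (real \<Rightarrow> 'w \<Rightarrow> 's) \<Rightarrow> 's set \<Rightarrow> (real \<Rightarrow> 's \<Rightarrow> 's \<Rightarrow> real) \<Rightarrow> bool" where
  "markov_chain M X S P \<longleftrightarrow>
     prob_space M \<and> countable S \<and> transition_function S P \<and>
     (\<forall>t\<ge>0. X t \<in> measurable M (count_space S)) \<and>
     (\<forall>s\<ge>0. \<forall>h\<ge>0. \<forall>T x. \<forall>a\<in>S. \<forall>y\<in>S. finite T \<longrightarrow> T \<subseteq> {0..s} \<longrightarrow>
        \<P>(\<omega> in M. X s \<omega> = a \<and> (\<forall>u\<in>T. X u \<omega> = x u)) > 0 \<longrightarrow>
        \<P>(\<omega> in M. X (s + h) \<omega> = y \<bar> X s \<omega> = a \<and> (\<forall>u\<in>T. X u \<omega> = x u)) = P h a y)"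

definition stationary_process :: "'w measure \<Rightarrow> (real \<Rightarrow> 'w \<Rightarrow> 's) \<Rightarrow> bool" where
  "stationary_process M X \<longleftrightarrow>
     (\<forall>T x. \<forall>h\<ge>0. finite T \<longrightarrow> T \<subseteq> {0..} \<longrightarrow>
        \<P>(\<omega> in M. \<forall>u\<in>T. X (u + h) \<omega> = x u) = \<P>(\<omega> in M. \<forall>u\<in>T. X u \<omega> = x u))"

definition equilibrium_distribution ::
    "'s set \<Rightarrow> (real \<Rightarrow> 's \<Rightarrow> 's \<Rightarrow> real) \<Rightarrow> ('s \<Rightarrow> real) \<Rightarrow> bool" where
  "equilibrium_distribution S P p \<longleftrightarrow>
     (\<forall>x\<in>S. 0 \<le> p x) \<and> (p has_sum 1) S \<and>
     (\<forall>t\<ge>0. \<forall>y\<in>S. ((\<lambda>x. p x * P t x y) has_sum p y) S)"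


text \<open>Customer types and nodes are the elements of the finite types \<open>'i\<close> and \<open>'j\<close>.
  Stages \<open>s\<close> and positions \<open>l\<close> are numbered from 1.  The fields are
  \<open>v(i)\<close>, \<open>f(i)\<close>, \<open>r(i,s)\<close>, \<open>\<mu>\<^sub>j(l)\<close>, \<open>\<gamma>\<^sub>j(n,l)\<close> and \<open>\<delta>\<^sub>j(n,l)\<close>.\<close>

record ('i, 'j) network =
  arrival_rate :: "'i \<Rightarrow> real"
  path_length :: "'i \<Rightarrow> nat"
  route :: "'i \<Rightarrow> nat \<Rightarrow> 'j"
  service_rate :: "'j \<Rightarrow> nat \<Rightarrow> real"
  velocity :: "'j \<Rightarrow> nat \<Rightarrow> nat \<Rightarrow> real"
  entry_prob :: "'j \<Rightarrow> nat \<Rightarrow> nat \<Rightarrow> real"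

definition open_network :: "('i::finite, 'j::finite) network \<Rightarrow> bool" where
  "open_network N \<longleftrightarrow>
     (\<forall>i. arrival_rate N i > 0) \<and>
     (\<forall>i. path_length N i \<ge> 1) \<and>
     (\<forall>j. \<forall>l\<ge>1. service_rate N j l > 0) \<and>
     (\<forall>j. \<forall>n\<ge>1. (\<forall>l\<in>{1..n}. velocity N j n l \<ge> 0) \<and> (\<Sum>l=1..n. velocity N j n l) = 1) \<and>
     (\<forall>j. \<forall>n\<ge>1. (\<forall>l\<in>{1..n}. entry_prob N j n l \<ge> 0) \<and> (\<Sum>l=1..n. entry_prob N j n l) = 1)"

text \<open>\<open>C j\<close> is the list \<open>c\<^sub>j\<close> of the pairs (type, stage) of the customers at node \<open>j\<close>,
  by increasing position.\<close>

type_synonym ('i, 'j) state = "'j \<Rightarrow> ('i \<times> nat) list"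

definition states :: "('i, 'j) network \<Rightarrow> ('i, 'j) state set" where
  "states N = {C. \<forall>j. \<forall>(i, s)\<in>set (C j). 1 \<le> s \<and> s \<le> path_length N i \<and> route N i s = j}"

abbreviation num :: "('i, 'j) state \<Rightarrow> 'j \<Rightarrow> nat" where
  "num C j \<equiv> length (C j)"

definition ctype :: "('i, 'j) state \<Rightarrow> 'j \<Rightarrow> nat \<Rightarrow> 'i" where
  "ctype C j l = fst (C j ! (l - 1))"

definition stage :: "('i, 'j) state \<Rightarrow> 'j \<Rightarrow> nat \<Rightarrow> nat" where
  "stage C j l = snd (C j ! (l - 1))"

definition remove_at :: "'j \<Rightarrow> nat \<Rightarrow> ('i, 'j) state \<Rightarrow> ('i, 'j) state" where
  "remove_at j l C = C(j := take (l - 1) (C j) @ drop l (C j))"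

definition insert_at :: "'j \<Rightarrow> nat \<Rightarrow> 'i \<times> nat \<Rightarrow> ('i, 'j) state \<Rightarrow> ('i, 'j) state" where
  "insert_at k r c C = C(k := take (r - 1) (C k) @ c # drop (r - 1) (C k))"

definition next_node :: "('i, 'j) network \<Rightarrow> ('i, 'j) state \<Rightarrow> 'j \<Rightarrow> nat \<Rightarrow> 'j" where
  "next_node N C j l = route N (ctype C j l) (stage C j l + 1)"

text \<open>The number of customers at the next node once the customer has arrived there;
  under feedback this customer has first left node \<open>j\<close>.\<close>

definition size_after :: "('i, 'j) network \<Rightarrow> ('i, 'j) state \<Rightarrow> 'j \<Rightarrow> nat \<Rightarrow> nat" where
  "size_after N C j l =
     (if next_node N C j l = j then num C j else num C (next_node N C j l) + 1)"

definition T_move :: "('i, 'j) network \<Rightarrow> 'j \<Rightarrow> nat \<Rightarrow> nat \<Rightarrow> ('i, 'j) state \<Rightarrow> ('i, 'j) state" where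
  "T_move N j l r C =
     insert_at (next_node N C j l) r (ctype C j l, stage C j l + 1) (remove_at j l C)"

definition T_leave :: "'j \<Rightarrow> nat \<Rightarrow> ('i, 'j) state \<Rightarrow> ('i, 'j) state" where
  "T_leave j l C = remove_at j l C"

definition T_enter :: "('i, 'j) network \<Rightarrow> 'i \<Rightarrow> nat \<Rightarrow> ('i, 'j) state \<Rightarrow> ('i, 'j) state" where
  "T_enter N i r C = insert_at (route N i 1) r (i, 1) C"

definition moves :: "('i, 'j) network \<Rightarrow> ('i, 'j) state \<Rightarrow> 'j \<Rightarrow> (nat \<times> nat) set" where
  "moves N C j = {(l, r). l \<in> {1..num C j} \<and> stage C j l < path_length N (ctype C j l) \<and>
     r \<in> {1..size_after N C j l}}"

definition leaves :: "('i, 'j) network \<Rightarrow> ('i, 'j) state \<Rightarrow> 'j \<Rightarrow> nat set" where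
  "leaves N C j = {l. l \<in> {1..num C j} \<and> stage C j l = path_length N (ctype C j l)}"

definition enters :: "('i, 'j) network \<Rightarrow> ('i, 'j) state \<Rightarrow> 'i \<Rightarrow> nat set" where
  "enters N C i = {1..num C (route N i 1) + 1}"

definition move_rate ::
    "('i, 'j) network \<Rightarrow> ('i, 'j) state \<Rightarrow> ('i, 'j) state \<Rightarrow> 'j \<Rightarrow> real" where
  "move_rate N C D j = (\<Sum>(g, h) \<in> {(g, h) \<in> moves N C j. T_move N j g h C = D}.
     service_rate N j g * velocity N j (num C j) g *
     entry_prob N (next_node N C j g) (size_after N C j g) h)"

definition leave_rate ::
    "('i, 'j) network \<Rightarrow> ('i, 'j) state \<Rightarrow> ('i, 'j) state \<Rightarrow> 'j \<Rightarrow> real" where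
  "leave_rate N C D j = (\<Sum>g \<in> {g \<in> leaves N C j. T_leave j g C = D}.
     service_rate N j g * velocity N j (num C j) g)"

definition enter_rate ::
    "('i, 'j) network \<Rightarrow> ('i, 'j) state \<Rightarrow> ('i, 'j) state \<Rightarrow> 'i \<Rightarrow> real" where
  "enter_rate N C D i = (\<Sum>h \<in> {h \<in> enters N C i. T_enter N i h C = D}.
     arrival_rate N i * entry_prob N (route N i 1) (num C (route N i 1) + 1) h)"

text \<open>At most one summand below is nonzero, since \<open>C\<close> and \<open>D\<close> determine the kind of the
  transition and the type and stage of the customer making it: see \<open>rate_move\<close>,
  \<open>rate_leave\<close> and \<open>rate_enter\<close>.\<close>

definition rate ::
    "('i::finite, 'j::finite) network \<Rightarrow> ('i, 'j) state \<Rightarrow> ('i, 'j) state \<Rightarrow> real" where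
  "rate N C D = (\<Sum>j\<in>UNIV. move_rate N C D j) + (\<Sum>j\<in>UNIV. leave_rate N C D j) +
     (\<Sum>i\<in>UNIV. enter_rate N C D i)"

definition content :: "('i, 'j::finite) state \<Rightarrow> ('i \<times> nat) multiset" where
  "content C = (\<Sum>j\<in>UNIV. mset (C j))"

lemma content_upd: "content (C(j := xs)) + mset (C j) = content C + mset xs"
proof -
  have "content (C(j := xs)) = mset xs + (\<Sum>k\<in>UNIV - {j}. mset (C k))"
    unfolding content_def by (subst sum.remove[of _ j]) (auto intro!: sum.cong)
  moreover have "content C = mset (C j) + (\<Sum>k\<in>UNIV - {j}. mset (C k))"
    unfolding content_def by (subst sum.remove[of _ j]) auto
  ultimately show ?thesis by (simp add: ac_simps)
qed

lemma content_insert: "content (insert_at k r c C) = add_mset c (content C)"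
proof -
  have "mset (take (r - 1) (C k) @ c # drop (r - 1) (C k)) = add_mset c (mset (C k))"
    by (metis append_take_drop_id mset.simps(2) mset_append union_mset_add_mset_right)
  then show ?thesis
    using content_upd[of C k "take (r - 1) (C k) @ c # drop (r - 1) (C k)"]
    by (simp add: insert_at_def)
qed

lemma content_remove:
  assumes "l \<in> {1..num C j}"
  shows "content C = add_mset (C j ! (l - 1)) (content (remove_at j l C))"
proof -
  have "C j = take (l - 1) (C j) @ C j ! (l - 1) # drop l (C j)"
    using assms id_take_nth_drop[of "l - 1" "C j"] by auto
  then have "mset (C j) = mset (take (l - 1) (C j) @ C j ! (l - 1) # drop l (C j))"
    by simp
  then have "mset (C j) = add_mset (C j ! (l - 1)) (mset (take (l - 1) (C j) @ drop l (C j)))"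
    by simp
  then show ?thesis
    using content_upd[of C j "take (l - 1) (C j) @ drop l (C j)"]
    by (simp add: remove_at_def)
qed

lemma content_move:
  fixes C :: "('i::finite, 'j::finite) state"
  assumes "(l, r) \<in> moves N C j"
  shows "add_mset (ctype C j l, stage C j l) (content (T_move N j l r C)) =
    add_mset (ctype C j l, stage C j l + 1) (content C)"
  using content_remove[of l C j] assms
  by (auto simp: T_move_def content_insert moves_def ctype_def stage_def)

lemma ctype_stage: "(ctype C j l, stage C j l) = C j ! (l - 1)"
  by (simp add: ctype_def stage_def)

lemma content_leave:
  fixes C :: "('i::finite, 'j::finite) state"
  assumes "l \<in> leaves N C j"
  shows "add_mset (ctype C j l, stage C j l) (content (T_leave j l C)) = content C"
  using content_remove[of l C j] assms
  unfolding ctype_stage T_leave_def leaves_def by simp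

lemma content_enter: "content (T_enter N i r C) = add_mset (i, 1) (content C)"
  by (simp add: T_enter_def content_insert)

lemma node_eq:
  assumes "C \<in> states N" "l \<in> {1..num C j}"
  shows "route N (ctype C j l) (stage C j l) = j"
proof -
  have "C j ! (l - 1) \<in> set (C j)" using assms(2) by auto
  then show ?thesis using assms(1) by (auto simp: states_def ctype_def stage_def split_beta)
qed

lemma size_move:
  fixes C :: "('i::finite, 'j::finite) state"
  assumes "(l, r) \<in> moves N C j"
  shows "size (content (T_move N j l r C)) = size (content C)"
  using arg_cong[OF content_move[OF assms], of size] by simp

lemma size_leave:
  fixes C :: "('i::finite, 'j::finite) state"
  assumes "l \<in> leaves N C j"
  shows "Suc (size (content (T_leave j l C))) = size (content C)"
  using arg_cong[OF content_leave[OF assms], of size] by simp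

lemma size_enter:
  fixes C :: "('i::finite, 'j::finite) state"
  shows "size (content (T_enter N i r C)) = Suc (size (content C))"
  by (simp add: content_enter)

lemma move_node_unique:
  fixes C :: "('i::finite, 'j::finite) state"
  assumes "C \<in> states N" "(l, r) \<in> moves N C j" "(g, h) \<in> moves N C k"
    "T_move N j l r C = T_move N k g h C"
  shows "j = k"
proof -
  define a where "a = (ctype C j l, stage C j l)"
  define b where "b = (ctype C k g, stage C k g)"
  define a' where "a' = (ctype C j l, stage C j l + 1)"
  define b' where "b' = (ctype C k g, stage C k g + 1)"
  let ?D = "content (T_move N j l r C)"
  have 1: "add_mset a ?D = add_mset a' (content C)"
    using content_move[OF assms(2)] by (simp add: a_def a'_def)
  have 2: "add_mset b ?D = add_mset b' (content C)"
    using content_move[OF assms(3)] assms(4) by (simp add: b_def b'_def)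
  have "a \<noteq> a'" "b \<noteq> b'" by (auto simp: a_def a'_def b_def b'_def)
  have "a = b"
  proof (rule ccontr)
    assume "a \<noteq> b"
    have "count (add_mset a ?D) a = count (add_mset a' (content C)) a"
      "count (add_mset b ?D) a = count (add_mset b' (content C)) a"
      using 1 2 by simp_all
    then show False using \<open>a \<noteq> a'\<close> \<open>a \<noteq> b\<close> by (auto split: if_splits)
  qed
  then show ?thesis
    using node_eq[OF assms(1), of l j] node_eq[OF assms(1), of g k] assms(2,3)
    by (auto simp: a_def b_def moves_def)
qed

lemma leave_node_unique:
  fixes C :: "('i::finite, 'j::finite) state"
  assumes "C \<in> states N" "l \<in> leaves N C j" "g \<in> leaves N C k"
    "T_leave j l C = T_leave k g C"
  shows "j = k"
proof -
  have "(ctype C j l, stage C j l) = (ctype C k g, stage C k g)"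
    using content_leave[OF assms(2)] content_leave[OF assms(3)] assms(4)
    by (metis add_mset_add_single add_left_imp_eq add_mset_eq_single)
  then show ?thesis
    using node_eq[OF assms(1), of l j] node_eq[OF assms(1), of g k] assms(2,3)
    by (auto simp: leaves_def)
qed

lemma enter_type_unique:
  fixes C :: "('i::finite, 'j::finite) state"
  shows "T_enter N i r C = T_enter N k h C \<Longrightarrow> i = k"
  using content_enter[of N i r C] content_enter[of N k h C] by auto

lemma move_rate_eq_0:
  "(\<And>g h. (g, h) \<in> moves N C j \<Longrightarrow> T_move N j g h C \<noteq> D) \<Longrightarrow> move_rate N C D j = 0"
  unfolding move_rate_def by (rule sum.neutral) auto

lemma leave_rate_eq_0:
  "(\<And>g. g \<in> leaves N C j \<Longrightarrow> T_leave j g C \<noteq> D) \<Longrightarrow> leave_rate N C D j = 0"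
  unfolding leave_rate_def by (rule sum.neutral) auto

lemma enter_rate_eq_0:
  "(\<And>h. h \<in> enters N C i \<Longrightarrow> T_enter N i h C \<noteq> D) \<Longrightarrow> enter_rate N C D i = 0"
  unfolding enter_rate_def by (rule sum.neutral) auto

lemma sum_single:
  fixes F :: "'a::finite \<Rightarrow> real"
  assumes "\<And>k. k \<noteq> j \<Longrightarrow> F k = 0"
  shows "sum F UNIV = F j"
  using sum.remove[of UNIV j F] assms by simp

lemma rate_move:
  fixes C :: "('i::finite, 'j::finite) state"
  assumes "C \<in> states N" "(l, r) \<in> moves N C j"
  shows "rate N C (T_move N j l r C) = move_rate N C (T_move N j l r C) j"
proof -
  let ?D = "T_move N j l r C"
  have "leave_rate N C ?D k = 0" for k
  proof (rule leave_rate_eq_0)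
    fix g assume "g \<in> leaves N C k"
    then have "size (content (T_leave k g C)) \<noteq> size (content ?D)"
      using size_leave[of g N C k] size_move[OF assms(2)] by linarith
    then show "T_leave k g C \<noteq> ?D" by metis
  qed
  moreover have "enter_rate N C ?D i = 0" for i
  proof (rule enter_rate_eq_0)
    fix h assume "h \<in> enters N C i"
    then have "size (content (T_enter N i h C)) \<noteq> size (content ?D)"
      using size_enter[of N i h C] size_move[OF assms(2)] by linarith
    then show "T_enter N i h C \<noteq> ?D" by metis
  qed
  moreover have "sum (move_rate N C ?D) UNIV = move_rate N C ?D j"
    using move_node_unique[OF assms] by (intro sum_single move_rate_eq_0) metis
  ultimately show ?thesis by (simp add: rate_def)
qed

lemma rate_leave:
  fixes C :: "('i::finite, 'j::finite) state"
  assumes "C \<in> states N" "l \<in> leaves N C j"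
  shows "rate N C (T_leave j l C) = leave_rate N C (T_leave j l C) j"
proof -
  let ?D = "T_leave j l C"
  have "move_rate N C ?D k = 0" for k
  proof (rule move_rate_eq_0)
    fix g h assume "(g, h) \<in> moves N C k"
    then have "size (content (T_move N k g h C)) \<noteq> size (content ?D)"
      using size_move[of g h N C k] size_leave[OF assms(2)] by linarith
    then show "T_move N k g h C \<noteq> ?D" by metis
  qed
  moreover have "enter_rate N C ?D i = 0" for i
  proof (rule enter_rate_eq_0)
    fix h assume "h \<in> enters N C i"
    then have "size (content (T_enter N i h C)) \<noteq> size (content ?D)"
      using size_enter[of N i h C] size_leave[OF assms(2)] by linarith
    then show "T_enter N i h C \<noteq> ?D" by metis
  qed
  moreover have "sum (leave_rate N C ?D) UNIV = leave_rate N C ?D j"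
    using leave_node_unique[OF assms] by (intro sum_single leave_rate_eq_0) metis
  ultimately show ?thesis by (simp add: rate_def)
qed

lemma rate_enter:
  fixes C :: "('i::finite, 'j::finite) state"
  shows "rate N C (T_enter N i r C) = enter_rate N C (T_enter N i r C) i"
proof -
  let ?D = "T_enter N i r C"
  have "move_rate N C ?D k = 0" for k
  proof (rule move_rate_eq_0)
    fix g h assume "(g, h) \<in> moves N C k"
    then have "size (content (T_move N k g h C)) \<noteq> size (content ?D)"
      using size_move[of g h N C k] size_enter[of N i r C] by linarith
    then show "T_move N k g h C \<noteq> ?D" by metis
  qed
  moreover have "leave_rate N C ?D k = 0" for k
  proof (rule leave_rate_eq_0)
    fix g assume "g \<in> leaves N C k"
    then have "size (content (T_leave k g C)) \<noteq> size (content ?D)"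
      using size_leave[of g N C k] size_enter[of N i r C] by linarith
    then show "T_leave k g C \<noteq> ?D" by metis
  qed
  moreover have "sum (enter_rate N C ?D) UNIV = enter_rate N C ?D i"
    by (intro sum_single enter_rate_eq_0) (auto dest: enter_type_unique)
  ultimately show ?thesis by (simp add: rate_def)
qed

text \<open>The total rate at which node \<open>j\<close> with \<open>n\<close> customers serves is
  \<open>\<Sum>l\<le>n. \<mu>\<^sub>j(l) \<gamma>\<^sub>j(n,l)\<close>, while the product form below has the factor \<open>\<mu>\<^sub>j(n)\<close>
  in its place.  Under \<open>open_network\<close> alone the two may differ, and the product form is then
  not an equilibrium: take one node, one type with path length 1, \<open>\<gamma>(n,1) = 1\<close>,
  \<open>\<delta>(n,n) = 1\<close>, \<open>\<mu>(l) = l\<close> and \<open>v < 1\<close>, which is the M/M/1 queue with service rate 1.  Its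
  equilibrium is geometric, whereas the formula gives a Poisson distribution.  The theorem
  therefore assumes that the two rates agree.\<close>

definition alpha :: "('i, 'j) network \<Rightarrow> 'j \<Rightarrow> 'i \<Rightarrow> nat \<Rightarrow> real" where
  "alpha N j i s = (if route N i s = j then arrival_rate N i else 0)"

definition load :: "('i::finite, 'j) network \<Rightarrow> 'j \<Rightarrow> real" where
  "load N j = (\<Sum>i\<in>UNIV. \<Sum>s=1..path_length N i. alpha N j i s)"

definition norm_term :: "('i::finite, 'j) network \<Rightarrow> 'j \<Rightarrow> nat \<Rightarrow> real" where
  "norm_term N j n = load N j ^ n / (\<Prod>l=1..n. service_rate N j l)"

definition norm_const :: "('i::finite, 'j) network \<Rightarrow> 'j \<Rightarrow> real" where
  "norm_const N j = inverse (\<Sum>n. norm_term N j n)"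

definition node_dist :: "('i::finite, 'j) network \<Rightarrow> ('i, 'j) state \<Rightarrow> 'j \<Rightarrow> real" where
  "node_dist N C j = norm_const N j *
     (\<Prod>l=1..num C j. alpha N j (ctype C j l) (stage C j l) / service_rate N j l)"

definition product_dist :: "('i::finite, 'j::finite) network \<Rightarrow> ('i, 'j) state \<Rightarrow> real" where
  "product_dist N C = (\<Prod>j\<in>UNIV. node_dist N C j)"

end

theory Submission
  imports Defs
begin

text \<open>
  The product weights, without normalisation, satisfy the balance equations of the rates. The
  reason is that each customer's contribution to the inflow into a state does not depend on the
  stage it has reached: removing the customer in position \<open>r\<close> of node \<open>k\<close> changes the weight by
  a factor that involves only its arrival rate and the rate of the last position, and summing
  over the positions that it may have occupied before turns the service effort of its previous
  node into the rate that the weight of the predecessor carries in its denominator. Thus the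
  inflow due to the customers of node \<open>k\<close> equals the outflow due to services at node \<open>k\<close>, and
  the inflow by departures equals the outflow by arrivals (\<open>global_balance\<close>).

  Balance of the rates does not by itself give invariance under the transition function: this
  may fail for explosive rates or for weights of infinite total mass. Both points are settled
  by going in the opposite direction, from an equilibrium of the transition function to the
  weights. An equilibrium \<open>p\<close> satisfies the balance equations at least as inequalities
  (\<open>equilibrium_superinvariant\<close>). The total number of remaining services is a potential with
  bounded drift and finite level sets, which forces equality for every summable solution of the
  inequalities (\<open>superinvariant_imp_invariant\<close>), and as the network can empty itself from any
  state, \<open>p\<close> is a multiple of the weights (\<open>superinvariant_unique\<close>). So the weights are
  summable, the series of each node converges, and the multiple is determined by the total mass
  1 (\<open>infsum_weight\<close>).

  Finally the stationary process supplies an equilibrium, namely its one-dimensional law. That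
  law is therefore the product form, which is thereby an equilibrium, and the only one.
\<close>

section \<open>Equilibria of chains with bounded drift\<close>

text \<open>The conservative chains treated here carry a potential \<open>w\<close> with finite level sets whose
  expected growth per unit time is at most \<open>c\<close>: for the network it is the number of services
  still to be performed. The drift bound is what rules out explosion, and \<open>descent\<close> makes the
  state \<open>e\<close> accessible from every state. Jumps change \<open>w\<close> by at most \<open>F\<close>, so every sum over the
  successors or the predecessors of a state is a finite one.\<close>

locale drift_chain =
  fixes S :: "'s set" and q :: "'s \<Rightarrow> 's \<Rightarrow> real" and w :: "'s \<Rightarrow> nat"
    and F :: nat and c :: real and e :: 's
  assumes q_nonneg: "x \<in> S \<Longrightarrow> y \<in> S \<Longrightarrow> 0 \<le> q x y"
    and q_self: "x \<in> S \<Longrightarrow> q x x = 0"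
    and finite_level: "finite {x \<in> S. w x \<le> n}"
    and bounded_jump: "x \<in> S \<Longrightarrow> y \<in> S \<Longrightarrow> q x y \<noteq> 0 \<Longrightarrow> w y \<le> w x + F \<and> w x \<le> w y + F"
    and drift: "x \<in> S \<Longrightarrow> (\<Sum>y | y \<in> S \<and> w y \<le> w x + F. q x y * (real (w y) - real (w x))) \<le> c"
    and c_nonneg: "0 \<le> c"
    and e_in: "e \<in> S"
    and descent: "x \<in> S \<Longrightarrow> x \<noteq> e \<Longrightarrow> \<exists>y\<in>S. 0 < q x y \<and> w y < w x"
begin

text \<open>One finite set serves for both directions of a jump: it contains every successor and
  every predecessor of \<open>x\<close>.\<close>

definition near :: "'s \<Rightarrow> 's set" where
  "near x = {y \<in> S. w y \<le> w x + F}"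

definition exit_rate :: "'s \<Rightarrow> real" where
  "exit_rate x = (\<Sum>y\<in>near x. q x y)"

definition inflow :: "('s \<Rightarrow> real) \<Rightarrow> 's \<Rightarrow> real" where
  "inflow m y = (\<Sum>x\<in>near y. m x * q x y)"

definition superinvariant :: "('s \<Rightarrow> real) \<Rightarrow> bool" where
  "superinvariant m \<longleftrightarrow> (\<forall>y\<in>S. inflow m y \<le> m y * exit_rate y)"

definition invariant :: "('s \<Rightarrow> real) \<Rightarrow> bool" where
  "invariant m \<longleftrightarrow> (\<forall>y\<in>S. inflow m y = m y * exit_rate y)"

lemma finite_near: "finite (near x)"
  unfolding near_def by (rule finite_level)

lemma near_subset: "near x \<subseteq> S"
  unfolding near_def by auto

lemma succ_near: "x \<in> S \<Longrightarrow> y \<in> S \<Longrightarrow> y \<notin> near x \<Longrightarrow> q x y = 0"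
  using bounded_jump unfolding near_def by auto

lemma pred_near: "x \<in> S \<Longrightarrow> y \<in> S \<Longrightarrow> x \<notin> near y \<Longrightarrow> q x y = 0"
  using bounded_jump unfolding near_def by auto

text \<open>Testing the defect \<open>d = m * exit_rate - inflow m \<ge> 0\<close> against the finitely supported
  function \<open>f x = max 0 (n - w x)\<close> moves the generator onto \<open>f\<close>, where the drift condition
  bounds it below by \<open>- c\<close>. Hence \<open>(n - w y) * d y\<close> is at most \<open>c\<close> times the total mass of \<open>m\<close>,
  whatever \<open>n\<close> is, and \<open>d\<close> must vanish. For an explosive chain mass could be lost at infinity
  and the conclusion could fail.\<close>

lemma superinvariant_imp_invariant:
  assumes nonneg: "\<And>x. x \<in> S \<Longrightarrow> 0 \<le> m x" and summable: "m summable_on S"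
    and super: "superinvariant m"
  shows "invariant m"
proof -
  define d where "d y = m y * exit_rate y - inflow m y" for y
  have d_nonneg: "0 \<le> d y" if "y \<in> S" for y
    using super that by (auto simp: superinvariant_def d_def)
  have bound: "(real n - real (w y)) * d y \<le> c * infsum m S" if y: "y \<in> S" "w y \<le> n" for y n
  proof -
    \<comment> \<open>Truncated subtraction of natural numbers makes \<open>f\<close> vanish where \<open>w x \<ge> n\<close>.\<close>
    define f where "f x = real (n - w x)" for x
    define A where "A = {x \<in> S. w x \<le> n}"
    define B where "B = A \<union> (\<Union>y\<in>A. near y)"
    have fA: "finite A" unfolding A_def by (rule finite_level)
    have fB: "finite B" unfolding B_def using fA finite_near by auto
    have AS: "A \<subseteq> S" unfolding A_def by auto
    have BS: "B \<subseteq> S" unfolding B_def using near_subset AS by auto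
    have f0: "f x = 0" if "x \<in> S - A" for x using that by (auto simp: f_def A_def)
    have in_eq: "(\<Sum>y\<in>A. f y * inflow m y) = (\<Sum>x\<in>B. m x * (\<Sum>y\<in>near x. q x y * f y))"
    proof -
      have "(\<Sum>y\<in>A. f y * inflow m y) = (\<Sum>y\<in>A. \<Sum>x\<in>B. m x * q x y * f y)"
      proof (rule sum.cong[OF refl])
        fix y assume y: "y \<in> A"
        have "inflow m y = (\<Sum>x\<in>B. m x * q x y)" unfolding inflow_def
        proof (rule sum.mono_neutral_left[OF fB])
          show "near y \<subseteq> B" using y by (auto simp: B_def)
          show "\<forall>x\<in>B - near y. m x * q x y = 0" using y AS BS pred_near by auto
        qed
        then show "f y * inflow m y = (\<Sum>x\<in>B. m x * q x y * f y)"
          by (simp add: sum_distrib_left mult_ac)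
      qed
      also have "\<dots> = (\<Sum>x\<in>B. \<Sum>y\<in>A. m x * q x y * f y)" by (rule sum.swap)
      also have "\<dots> = (\<Sum>x\<in>B. m x * (\<Sum>y\<in>near x. q x y * f y))"
      proof (rule sum.cong[OF refl])
        fix x assume x: "x \<in> B"
        have "(\<Sum>y\<in>A. q x y * f y) = (\<Sum>y\<in>A \<union> near x. q x y * f y)"
          by (rule sum.mono_neutral_left) (use fA finite_near f0 near_subset in auto)
        also have "\<dots> = (\<Sum>y\<in>near x. q x y * f y)"
        proof (rule sum.mono_neutral_right)
          show "\<forall>y\<in>A \<union> near x - near x. q x y * f y = 0" using succ_near x AS BS by auto
        qed (use fA finite_near in auto)
        finally show "(\<Sum>y\<in>A. m x * q x y * f y) = m x * (\<Sum>y\<in>near x. q x y * f y)"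
          by (simp add: sum_distrib_left[symmetric] mult.assoc)
      qed
      finally show ?thesis .
    qed
    have out_eq: "(\<Sum>y\<in>A. f y * (m y * exit_rate y)) = (\<Sum>x\<in>B. m x * (\<Sum>y\<in>near x. q x y * f x))"
    proof -
      have "(\<Sum>y\<in>A. f y * (m y * exit_rate y)) = (\<Sum>y\<in>B. f y * (m y * exit_rate y))"
        by (rule sum.mono_neutral_left) (use fB f0 BS in \<open>auto simp: B_def\<close>)
      then show ?thesis by (simp add: exit_rate_def sum_distrib_left mult_ac)
    qed
    have gen: "(\<Sum>y\<in>near x. q x y * (f x - f y)) \<le> c" if x: "x \<in> S" for x
    proof (cases "w x \<le> n")
      case True
      have "(\<Sum>y\<in>near x. q x y * (f x - f y)) \<le> (\<Sum>y\<in>near x. q x y * (real (w y) - real (w x)))"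
        using True x near_subset q_nonneg by (intro sum_mono mult_left_mono) (auto simp: f_def)
      also have "\<dots> \<le> c" using drift[OF x] by (simp add: near_def)
      finally show ?thesis .
    next
      case False
      then have "(\<Sum>y\<in>near x. q x y * (f x - f y)) \<le> 0"
        using x near_subset q_nonneg
        by (intro sum_nonpos mult_nonneg_nonpos) (auto simp: f_def)
      then show ?thesis using c_nonneg by linarith
    qed
    have "(real n - real (w y)) * d y = f y * d y" using y by (simp add: f_def)
    also have "\<dots> \<le> (\<Sum>y\<in>A. f y * d y)"
      using y fA AS d_nonneg by (intro member_le_sum) (auto simp: f_def A_def)
    also have "\<dots> = (\<Sum>y\<in>A. f y * (m y * exit_rate y)) - (\<Sum>y\<in>A. f y * inflow m y)"
      by (simp add: d_def sum_subtractf right_diff_distrib)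
    also have "\<dots> = (\<Sum>x\<in>B. m x * (\<Sum>y\<in>near x. q x y * (f x - f y)))"
      unfolding in_eq out_eq by (simp add: sum_subtractf right_diff_distrib)
    also have "\<dots> \<le> (\<Sum>x\<in>B. m x * c)"
      using BS nonneg gen by (intro sum_mono mult_left_mono) auto
    also have "\<dots> = c * sum m B" by (simp add: sum_distrib_left mult.commute)
    also have "\<dots> \<le> c * infsum m S"
      using finite_sum_le_infsum[OF summable fB BS] nonneg c_nonneg by (intro mult_left_mono) auto
    finally show ?thesis .
  qed
  have "d y = 0" if y: "y \<in> S" for y
  proof (rule ccontr)
    assume "d y \<noteq> 0"
    then have "0 < d y" using d_nonneg[OF y] by simp
    then obtain k :: nat where "c * infsum m S < real k * d y"
      using reals_Archimedean3 by blast
    moreover have "real k * d y \<le> c * infsum m S"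
      using bound[OF y, of "w y + k"] by simp
    ultimately show False by linarith
  qed
  then show ?thesis by (simp add: invariant_def d_def)
qed

text \<open>If \<open>r\<close> vanishes at a state then so does its inflow, and with it \<open>r\<close> at every predecessor
  of that state; going back along descending jumps from \<open>e\<close> reaches all states.\<close>

lemma invariant_vanishes:
  assumes nonneg: "\<And>x. x \<in> S \<Longrightarrow> 0 \<le> r x" and inv: "invariant r" and "r e = 0" and "x \<in> S"
  shows "r x = 0"
  using \<open>x \<in> S\<close>
proof (induction "w x" arbitrary: x rule: less_induct)
  case less
  show ?case
  proof (cases "x = e")
    case False
    obtain y where y: "y \<in> S" "0 < q x y" "w y < w x" using descent[OF less.prems False] by auto
    have "r y = 0" using less.hyps[OF y(3,1)] .
    then have "inflow r y = 0" using inv y(1) by (simp add: invariant_def)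
    then have "\<forall>x\<in>near y. r x * q x y = 0"
      unfolding inflow_def using finite_near near_subset[of y] nonneg q_nonneg y(1)
      by (subst (asm) sum_nonneg_eq_0_iff) (auto intro!: mult_nonneg_nonneg)
    moreover have "x \<in> near y" using pred_near[OF less.prems y(1)] y(2) by auto
    ultimately show ?thesis using y(2) by auto
  qed (simp add: \<open>r e = 0\<close>)
qed

lemma invariant_diff: "invariant m \<Longrightarrow> invariant m' \<Longrightarrow> invariant (\<lambda>x. m x - m' x)"
  by (simp add: invariant_def inflow_def sum_subtractf left_diff_distrib)

lemma invariant_scale: "invariant m \<Longrightarrow> invariant (\<lambda>x. a * m x)"
  unfolding invariant_def inflow_def by (simp add: sum_distrib_left[symmetric] mult.assoc)

lemma superinvariant_min:
  assumes "superinvariant m" "superinvariant m'"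
  shows "superinvariant (\<lambda>x. min (m x) (m' x))"
  unfolding superinvariant_def
proof
  fix y assume y: "y \<in> S"
  have le: "inflow (\<lambda>x. min (m x) (m' x)) y \<le> inflow k y" if "k = m \<or> k = m'" for k
    unfolding inflow_def using that near_subset q_nonneg y by (intro sum_mono mult_right_mono) auto
  have "inflow (\<lambda>x. min (m x) (m' x)) y \<le> m y * exit_rate y"
    "inflow (\<lambda>x. min (m x) (m' x)) y \<le> m' y * exit_rate y"
    using le[of m] le[of m'] assms y by (force simp: superinvariant_def)+
  then show "inflow (\<lambda>x. min (m x) (m' x)) y \<le> min (m y) (m' y) * exit_rate y"
    by (simp add: min_def)
qed

text \<open>Scale \<open>g\<close> to agree with \<open>p\<close> at \<open>e\<close>. The pointwise minimum \<open>m\<close> of \<open>p\<close> and the scaled \<open>g\<close>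
  is again superinvariant and summable, hence invariant; \<open>p - m\<close> is then invariant, nonnegative
  and zero at \<open>e\<close>, so \<open>p\<close> lies below the scaled \<open>g\<close>, and the same argument applied to the
  difference gives equality. The passage through the minimum is what allows \<open>g\<close> to have
  infinite mass, so that the existence of an equilibrium yields the summability of \<open>g\<close> instead
  of presupposing it.\<close>

theorem superinvariant_unique:
  assumes p: "\<And>x. x \<in> S \<Longrightarrow> 0 \<le> p x" "p summable_on S" "superinvariant p"
    and g: "\<And>x. x \<in> S \<Longrightarrow> 0 \<le> g x" "invariant g" "0 < g e"
    and x: "x \<in> S"
  shows "p x = p e / g e * g x"
proof -
  define a where "a = p e / g e"
  define m where "m x = min (p x) (a * g x)" for x
  have a: "0 \<le> a" using p(1)[OF e_in] g(3) by (simp add: a_def)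
  have ag: "invariant (\<lambda>x. a * g x)" by (rule invariant_scale[OF g(2)])
  have pinv: "invariant p" by (rule superinvariant_imp_invariant[OF p])
  have "superinvariant (\<lambda>x. min (p x) (a * g x))"
    using ag by (intro superinvariant_min p(3)) (simp add: superinvariant_def invariant_def)
  moreover have m_nonneg: "0 \<le> m x" if "x \<in> S" for x using p(1) g(1) a that by (simp add: m_def)
  moreover have "m summable_on S"
    by (rule summable_on_comparison_test[OF p(2)]) (use m_nonneg in \<open>auto simp: m_def\<close>)
  ultimately have minv: "invariant m"
    by (intro superinvariant_imp_invariant) (auto simp: m_def[abs_def])
  have me: "m e = p e" using g(3) by (simp add: m_def a_def)
  have "p z - m z = 0" if "z \<in> S" for z
    using invariant_vanishes[OF _ invariant_diff[OF pinv minv] _ that] me by (simp add: m_def)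
  then have "p z \<le> a * g z" if "z \<in> S" for z
    using that unfolding m_def by (smt (verit))
  then have "a * g x - p x = 0"
    using invariant_vanishes[OF _ invariant_diff[OF ag pinv] _ x] g(3) by (simp add: a_def)
  then show ?thesis by (simp add: a_def)
qed

text \<open>From \<open>p y = (\<Sum>x. p x * P h x y)\<close>, dropping all but finitely many \<open>x \<noteq> y\<close>, dividing
  by \<open>h\<close> and letting \<open>h\<close> tend to 0 gives one inequality. Equality would need an interchange of
  limit and infinite sum; it follows instead from \<open>superinvariant_imp_invariant\<close>.\<close>

lemma equilibrium_superinvariant:
  assumes rates: "has_transition_rates S P q" and eq: "equilibrium_distribution S P p"
    and tf: "transition_function S P"
  shows "superinvariant p"
  unfolding superinvariant_def
proof
  fix y assume y: "y \<in> S"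
  define A where "A = near y - {y}"
  have A: "finite A" "A \<subseteq> S - {y}" using finite_near near_subset by (auto simp: A_def)
  have exit: "(\<Sum>\<^sub>\<infinity>z\<in>S - {y}. q y z) = exit_rate y"
  proof -
    have "(\<Sum>\<^sub>\<infinity>z\<in>S - {y}. q y z) = (\<Sum>\<^sub>\<infinity>z\<in>near y. q y z)"
      using succ_near[OF y] q_self[OF y] near_subset by (intro infsum_cong_neutral) auto
    then show ?thesis using finite_near by (simp add: exit_rate_def)
  qed
  have infl: "inflow p y = (\<Sum>x\<in>A. p x * q x y)"
    unfolding inflow_def A_def using finite_near q_self[OF y] by (intro sum.mono_neutral_right) auto
  have step: "(\<Sum>x\<in>A. p x * (P h x y / h)) \<le> p y * ((1 - P h y y) / h)" if h: "h > 0" for h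
  proof -
    have hs: "((\<lambda>x. p x * P h x y) has_sum p y) S"
      using eq y h by (simp add: equilibrium_distribution_def)
    have "(\<Sum>x\<in>insert y A. p x * P h x y) \<le> p y"
      using eq tf h y A by (intro finite_sum_le_has_sum[OF hs])
        (auto simp: equilibrium_distribution_def transition_function_def)
    moreover have "(\<Sum>x\<in>insert y A. p x * P h x y) = p y * P h y y + (\<Sum>x\<in>A. p x * P h x y)"
      using A by (subst sum.insert) auto
    ultimately have "(\<Sum>x\<in>A. p x * P h x y) / h \<le> (p y * (1 - P h y y)) / h"
      using h by (intro divide_right_mono) (auto simp: algebra_simps)
    then show ?thesis by (simp add: sum_divide_distrib)
  qed
  have "((\<lambda>h. \<Sum>x\<in>A. p x * (P h x y / h)) \<longlongrightarrow> (\<Sum>x\<in>A. p x * q x y)) (at_right 0)"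
    using rates y A by (intro tendsto_sum tendsto_mult tendsto_const)
      (auto simp: has_transition_rates_def)
  moreover have "((\<lambda>h. p y * ((1 - P h y y) / h)) \<longlongrightarrow> p y * exit_rate y) (at_right 0)"
    using rates y exit by (intro tendsto_mult tendsto_const) (auto simp: has_transition_rates_def)
  moreover have "eventually (\<lambda>h. (\<Sum>x\<in>A. p x * (P h x y / h)) \<le> p y * ((1 - P h y y) / h)) (at_right 0)"
    using step by (intro eventually_at_right_less[THEN eventually_mono]) auto
  ultimately show "inflow p y \<le> p y * exit_rate y"
    unfolding infl by (intro tendsto_le[of "at_right (0::real)"]) auto
qed

end

section \<open>The law of a stationary Markov chain\<close>

lemma equilibrium_cong:
  assumes "\<And>x. x \<in> S \<Longrightarrow> p x = p' x"
  shows "equilibrium_distribution S P p \<longleftrightarrow> equilibrium_distribution S P p'"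
proof -
  have "((\<lambda>x. p x * P t x y) has_sum p y) S \<longleftrightarrow> ((\<lambda>x. p' x * P t x y) has_sum p' y) S" if "y \<in> S" for t y
    using assms that has_sum_cong[of S "\<lambda>x. p x * P t x y" "\<lambda>x. p' x * P t x y"] by simp
  moreover have "(p has_sum 1) S \<longleftrightarrow> (p' has_sum 1) S"
    using assms by (rule has_sum_cong)
  ultimately show ?thesis
    unfolding equilibrium_distribution_def by (simp add: assms cong: ball_cong)
qed

text \<open>An enumeration of \<open>S\<close>, finite or infinite, turns the partition into a sequence of
  events, some of them empty, to which countable additivity applies.\<close>

lemma has_sum_prob_partition:
  assumes "prob_space M" and S: "countable S" and Y: "Y \<in> measurable M (count_space S)"
    and A: "A \<in> sets M"
  shows "((\<lambda>x. measure M {\<omega> \<in> A. Y \<omega> = x}) has_sum measure M A) S"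
proof -
  interpret prob_space M by fact
  define B where "B n = {\<omega> \<in> A. to_nat_on S (Y \<omega>) = n}" for n
  have AM: "A \<subseteq> space M" using A by (rule sets.sets_into_space)
  have inS: "Y \<omega> \<in> S" if "\<omega> \<in> A" for \<omega> using measurable_space[OF Y] that AM by auto
  have meas: "B n \<in> sets M" for n
  proof -
    have "B n = (Y -` {x \<in> S. to_nat_on S x = n} \<inter> space M) \<inter> A"
      using AM inS by (auto simp: B_def)
    then show ?thesis using measurable_sets[OF Y, of "{x \<in> S. to_nat_on S x = n}"] A by auto
  qed
  have UN: "(\<Union>n. B n) = A" by (auto simp: B_def)
  have "(\<lambda>n. measure M (B n)) sums measure M (\<Union>n. B n)"
    using meas by (intro measure_UNION) (auto simp: disjoint_family_on_def B_def)
  then have "((\<lambda>n. measure M (B n)) has_sum measure M A) UNIV"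
    using UN by (intro sums_nonneg_imp_has_sum) auto
  moreover have "measure M (B n) = 0" if "n \<notin> to_nat_on S ` S" for n
  proof -
    have "B n = {}" using that inS by (auto simp: B_def)
    then show ?thesis by simp
  qed
  ultimately have "((\<lambda>n. measure M (B n)) has_sum measure M A) (to_nat_on S ` S)"
    by (subst has_sum_cong_neutral[where T = UNIV and g = "\<lambda>n. measure M (B n)"]) auto
  then have "((\<lambda>x. measure M (B (to_nat_on S x))) has_sum measure M A) S"
    by (simp add: has_sum_reindex[OF inj_on_to_nat_on[OF S]] o_def)
  moreover have "B (to_nat_on S x) = {\<omega> \<in> A. Y \<omega> = x}" if "x \<in> S" for x
    using that inS inj_on_to_nat_on[OF S] by (auto simp: B_def inj_on_def)
  ultimately show ?thesis by (simp cong: has_sum_cong)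
qed

lemma stationary_marginal:
  assumes "stationary_process M X" "0 \<le> t"
  shows "\<P>(\<omega> in M. X t \<omega> = x) = \<P>(\<omega> in M. X 0 \<omega> = x)"
proof -
  have "\<P>(\<omega> in M. \<forall>u\<in>{0}. X (u + t) \<omega> = x) = \<P>(\<omega> in M. \<forall>u\<in>{0}. X u \<omega> = x)"
    by (rule assms(1)[unfolded stationary_process_def, rule_format]) (use assms(2) in auto)
  then show ?thesis by simp
qed

lemma marginal_equilibrium:
  assumes chain: "markov_chain M X S P" and stat: "stationary_process M X"
  shows "equilibrium_distribution S P (\<lambda>x. \<P>(\<omega> in M. X 0 \<omega> = x))"
  unfolding equilibrium_distribution_def
proof (intro conjI ballI allI impI)
  interpret prob_space M using chain by (simp add: markov_chain_def)
  have S: "countable S" and meas: "\<And>t. 0 \<le> t \<Longrightarrow> X t \<in> measurable M (count_space S)"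
    using chain by (auto simp: markov_chain_def)
  note part = has_sum_prob_partition[OF prob_space_axioms S meas]
  show "((\<lambda>x. \<P>(\<omega> in M. X 0 \<omega> = x)) has_sum 1) S"
    using part[of 0 "space M"] by (simp add: prob_space)
  fix t :: real and y assume t: "0 \<le> t" and y: "y \<in> S"
  have A: "{\<omega> \<in> space M. X t \<omega> = y} \<in> sets M"
  proof -
    have "{\<omega> \<in> space M. X t \<omega> = y} = X t -` {y} \<inter> space M" by auto
    then show ?thesis using measurable_sets[OF meas[OF t], of "{y}"] y by simp
  qed
  have joint: "\<P>(\<omega> in M. X 0 \<omega> = x) * P t x y = measure M {\<omega> \<in> {\<omega> \<in> space M. X t \<omega> = y}. X 0 \<omega> = x}"
    if x: "x \<in> S" for x
  proof (cases "\<P>(\<omega> in M. X 0 \<omega> = x) > 0")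
    case True
    have "\<P>(\<omega> in M. X (0 + t) \<omega> = y \<bar> X 0 \<omega> = x \<and> (\<forall>u\<in>{}. X u \<omega> = x)) = P t x y"
      by (rule chain[unfolded markov_chain_def, THEN conjunct2, THEN conjunct2, THEN conjunct2,
            THEN conjunct2, rule_format]) (use t x y True in auto)
    then have "\<P>(\<omega> in M. X t \<omega> = y \<and> X 0 \<omega> = x) = \<P>(\<omega> in M. X 0 \<omega> = x) * P t x y"
      using True by (simp add: cond_prob_def field_simps)
    then show ?thesis by (simp add: conj_assoc)
  next
    case False
    then have 0: "\<P>(\<omega> in M. X 0 \<omega> = x) = 0" by (simp add: zero_less_measure_iff)
    have "{\<omega> \<in> space M. X 0 \<omega> = x} = X 0 -` {x} \<inter> space M" by auto
    then have "{\<omega> \<in> space M. X 0 \<omega> = x} \<in> sets M"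
      using measurable_sets[OF meas[of 0], of "{x}"] x by simp
    then have "measure M {\<omega> \<in> {\<omega> \<in> space M. X t \<omega> = y}. X 0 \<omega> = x} \<le> \<P>(\<omega> in M. X 0 \<omega> = x)"
      by (intro finite_measure_mono) auto
    then show ?thesis using 0 by (simp add: measure_le_0_iff)
  qed
  have "((\<lambda>x. \<P>(\<omega> in M. X 0 \<omega> = x) * P t x y) has_sum \<P>(\<omega> in M. X t \<omega> = y)) S"
    using part[of 0, OF _ A] by (simp add: joint cong: has_sum_cong)
  then show "((\<lambda>x. \<P>(\<omega> in M. X 0 \<omega> = x) * P t x y) has_sum \<P>(\<omega> in M. X 0 \<omega> = y)) S"
    by (simp add: stationary_marginal[OF stat t])
qed simp

section \<open>Remaining services\<close>

text \<open>The number of services that a customer has still to receive, counting the current one.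
  Their total over the network falls by exactly 1 at every move or departure and grows only at
  arrivals, whose total rate is bounded; this makes it the potential of a \<open>drift_chain\<close>, even
  when the service rates are unbounded.\<close>

definition remaining :: "('i, 'j) network \<Rightarrow> 'i \<times> nat \<Rightarrow> nat" where
  "remaining N c = path_length N (fst c) + 1 - snd c"

definition work :: "('i, 'j::finite) network \<Rightarrow> ('i, 'j) state \<Rightarrow> nat" where
  "work N C = (\<Sum>c\<in>#content C. remaining N c)"

lemma work_move:
  fixes C :: "('i::finite, 'j::finite) state"
  assumes "(l, r) \<in> moves N C j"
  shows "work N C = work N (T_move N j l r C) + 1"
proof -
  let ?i = "ctype C j l" and ?s = "stage C j l"
  have "work N (T_move N j l r C) + remaining N (?i, ?s) = work N C + remaining N (?i, ?s + 1)"
    using arg_cong[OF content_move[OF assms], of "\<lambda>M. \<Sum>c\<in>#M. remaining N c"]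
    by (simp add: work_def)
  moreover have "remaining N (?i, ?s) = remaining N (?i, ?s + 1) + 1"
    using assms by (auto simp: remaining_def moves_def)
  ultimately show ?thesis by simp
qed

lemma work_leave:
  fixes C :: "('i::finite, 'j::finite) state"
  assumes "l \<in> leaves N C j"
  shows "work N C = work N (T_leave j l C) + 1"
  using arg_cong[OF content_leave[OF assms], of "\<lambda>M. \<Sum>c\<in>#M. remaining N c"] assms
  by (simp add: work_def remaining_def leaves_def)

lemma work_enter:
  fixes C :: "('i::finite, 'j::finite) state"
  shows "work N (T_enter N i r C) = work N C + path_length N i"
  by (simp add: work_def remaining_def content_enter)

definition customers :: "('i, 'j) network \<Rightarrow> 'j \<Rightarrow> ('i \<times> nat) set" where
  "customers N j = {(i, s). 1 \<le> s \<and> s \<le> path_length N i \<and> route N i s = j}"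

lemma states_iff: "C \<in> states N \<longleftrightarrow> (\<forall>j. set (C j) \<subseteq> customers N j)"
  by (auto simp: states_def customers_def)

lemma finite_customers: "finite (customers (N :: ('i::finite, 'j) network) j)"
proof (rule finite_subset)
  show "customers N j \<subseteq> (SIGMA i:UNIV. {1..path_length N i})" by (auto simp: customers_def)
qed auto

text \<open>Every customer has at least one service left, so bounded work bounds the number of
  customers.\<close>

lemma finite_work_level:
  fixes N :: "('i::finite, 'j::finite) network"
  shows "finite {C \<in> states N. work N C \<le> n}"
proof (rule finite_subset)
  let ?B = "\<lambda>j. {xs. set xs \<subseteq> customers N j \<and> length xs \<le> n}"
  show "{C \<in> states N. work N C \<le> n} \<subseteq> (\<Pi>\<^sub>E j\<in>UNIV. ?B j)"
  proof
    fix C assume "C \<in> {C \<in> states N. work N C \<le> n}"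
    then have C: "C \<in> states N" "work N C \<le> n" by auto
    have "num C j \<le> n" for j
    proof -
      have sub: "set_mset (content C) \<subseteq> (\<Union>j. customers N j)"
        using C(1) by (auto simp: content_def states_iff set_mset_sum)
      have "mset (C j) \<subseteq># content C"
        unfolding content_def by (subst sum.remove[of _ j]) auto
      then have "num C j \<le> size (content C)" using size_mset_mono by fastforce
      also have "\<dots> = (\<Sum>c\<in>#content C. 1)" by simp
      also have "\<dots> \<le> work N C"
        unfolding work_def using sub
        by (intro sum_mset_mono) (fastforce simp: remaining_def customers_def)
      finally show ?thesis using C(2) by simp
    qed
    then show "C \<in> (\<Pi>\<^sub>E j\<in>UNIV. ?B j)" using C(1) by (auto simp: states_iff)
  qed
  show "finite (\<Pi>\<^sub>E j\<in>UNIV. ?B j)"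
    by (intro finite_PiE finite_lists_length_le finite_customers) auto
qed

section \<open>Inserting and removing customers\<close>

lemma remove_insert:
  assumes "1 \<le> r" "r \<le> num C k + 1"
  shows "remove_at k r (insert_at k r c C) = C"
proof -
  have "r - 1 \<le> num C k" "r = Suc (r - 1)" using assms by auto
  then have "take (r - 1) (insert_at k r c C k) = take (r - 1) (C k)"
     "drop r (insert_at k r c C k) = drop (r - 1) (C k)"
    by (cases r; simp add: insert_at_def)+
  then show ?thesis by (simp add: remove_at_def) (simp add: insert_at_def fun_upd_idem)
qed

lemma insert_remove:
  assumes "1 \<le> l" "l \<le> num C j"
  shows "insert_at j l (C j ! (l - 1)) (remove_at j l C) = C"
proof -
  have "C j = take (l - 1) (C j) @ C j ! (l - 1) # drop l (C j)"
    using assms id_take_nth_drop[of "l - 1" "C j"] by auto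
  then show ?thesis using assms by (simp add: insert_at_def remove_at_def fun_upd_idem)
qed

lemma num_insert: "num (insert_at k r c C) j = num C j + of_bool (j = k)"
  by (auto simp: insert_at_def)

lemma num_remove:
  "1 \<le> l \<Longrightarrow> l \<le> num C k \<Longrightarrow> num (remove_at k l C) j = num C j - of_bool (j = k)"
  by (auto simp: remove_at_def)

lemma nth_insert:
  "1 \<le> r \<Longrightarrow> r \<le> num C k + 1 \<Longrightarrow> insert_at k r c C k ! (r - 1) = c"
  by (auto simp: insert_at_def nth_append)

lemma states_insert:
  "1 \<le> r \<Longrightarrow> insert_at k r c C \<in> states N \<longleftrightarrow> C \<in> states N \<and> c \<in> customers N k"
proof -
  have "set (C k) = set (take (r - 1) (C k)) \<union> set (drop (r - 1) (C k))"
    by (metis append_take_drop_id set_append)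
  then have "set (insert_at k r c C k) = insert c (set (C k))" by (auto simp: insert_at_def)
  moreover have "insert_at k r c C j = C j" if "j \<noteq> k" for j using that by (simp add: insert_at_def)
  ultimately show ?thesis unfolding states_iff
    by (metis insert_subset)
qed

lemma states_remove:
  assumes "C \<in> states N"
  shows "remove_at j l C \<in> states N"
  using assms set_take_subset[of "l - 1" "C j"] set_drop_subset[of l "C j"]
  by (auto simp: states_iff remove_at_def)

lemma customer_at:
  assumes "C \<in> states N" "1 \<le> l" "l \<le> num C j"
  shows "(ctype C j l, stage C j l) \<in> customers N j"
proof -
  have "C j ! (l - 1) \<in> set (C j)" using assms by auto
  then show ?thesis using assms(1) unfolding ctype_stage states_iff by auto
qed

section \<open>The product weights\<close>

text \<open>The product form without its normalising constants, and with the customers indexed by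
  list elements instead of positions.\<close>

definition node_weight :: "('i, 'j) network \<Rightarrow> 'j \<Rightarrow> ('i \<times> nat) list \<Rightarrow> real" where
  "node_weight N j xs =
     (\<Prod>(i, s)\<leftarrow>xs. alpha N j i s) / (\<Prod>l=1..length xs. service_rate N j l)"

definition weight :: "('i, 'j::finite) network \<Rightarrow> ('i, 'j) state \<Rightarrow> real" where
  "weight N C = (\<Prod>j\<in>UNIV. node_weight N j (C j))"

text \<open>The numerator ignores the order of the customers, and the denominator depends only on
  how many there are; hence the new factor has the service rate of the last position, not that
  of \<open>r\<close>.\<close>

lemma weight_insert:
  fixes C :: "('i, 'j::finite) state"
  assumes "route N i s = k"
  shows "weight N (insert_at k r (i, s) C) =
    weight N C * arrival_rate N i / service_rate N k (num C k + 1)"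
proof -
  let ?xs = "take (r - 1) (C k)" and ?ys = "drop (r - 1) (C k)"
  have "(\<Prod>(i, s)\<leftarrow>C k. alpha N k i s) = (\<Prod>(i, s)\<leftarrow>?xs. alpha N k i s) * (\<Prod>(i, s)\<leftarrow>?ys. alpha N k i s)"
    by (metis append_take_drop_id map_append prod_list.append)
  then have k: "node_weight N k (insert_at k r (i, s) C k) =
      node_weight N k (C k) * (arrival_rate N i / service_rate N k (num C k + 1))"
    using assms num_insert[of k r "(i, s)" C k]
    by (simp add: node_weight_def) (simp add: insert_at_def alpha_def)
  have "weight N (insert_at k r (i, s) C) = node_weight N k (insert_at k r (i, s) C k) *
      (\<Prod>j\<in>UNIV - {k}. node_weight N j (C j))"
    unfolding weight_def by (subst prod.remove[of _ k]) (auto simp: insert_at_def)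
  moreover have "weight N C = node_weight N k (C k) * (\<Prod>j\<in>UNIV - {k}. node_weight N j (C j))"
    unfolding weight_def by (subst prod.remove[of _ k]) auto
  ultimately show ?thesis by (simp add: k)
qed

lemma product_dist_eq:
  fixes C :: "('i::finite, 'j::finite) state"
  shows "product_dist N C = (\<Prod>j\<in>UNIV. norm_const N j) * weight N C"
proof -
  have "(\<Prod>(i, s)\<leftarrow>C j. alpha N j i s) = (\<Prod>l=1..num C j. alpha N j (ctype C j l) (stage C j l))" for j
  proof -
    have "(\<Prod>(i, s)\<leftarrow>C j. alpha N j i s) = (\<Prod>l<num C j. case_prod (alpha N j) (C j ! l))"
      by (simp add: prod.list_conv_set_nth lessThan_atLeast0)
    also have "\<dots> = (\<Prod>l=1..num C j. case_prod (alpha N j) (C j ! (l - 1)))"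
      by (rule prod.reindex_bij_witness[of _ "\<lambda>l. l - 1" Suc]) auto
    finally show ?thesis by (simp add: ctype_def stage_def case_prod_beta)
  qed
  then show ?thesis
    by (simp add: product_dist_def node_dist_def weight_def node_weight_def prod.distrib prod_dividef)
qed

section \<open>Total mass of the product weights\<close>

lemma sum_prod_list_length:
  fixes f :: "'a \<Rightarrow> 'b::comm_semiring_1"
  assumes "finite E"
  shows "(\<Sum>xs | set xs \<subseteq> E \<and> length xs = n. \<Prod>x\<leftarrow>xs. f x) = sum f E ^ n"
proof (induction n)
  case 0
  have "{xs. set xs \<subseteq> E \<and> length xs = 0} = {[]}" by auto
  then show ?case by simp
next
  case (Suc n)
  let ?L = "{xs. set xs \<subseteq> E \<and> length xs = n}"
  have "(\<Sum>xs | set xs \<subseteq> E \<and> length xs = Suc n. \<Prod>x\<leftarrow>xs. f x) =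
      (\<Sum>(xs, x)\<in>?L \<times> E. f x * (\<Prod>x\<leftarrow>xs. f x))"
    unfolding lists_length_Suc_eq by (subst sum.reindex) (auto simp: inj_on_def case_prod_beta)
  also have "\<dots> = (\<Sum>xs\<in>?L. \<Prod>x\<leftarrow>xs. f x) * sum f E"
    unfolding sum.cartesian_product[symmetric] sum_product by (simp only: mult.commute)
  finally show ?case using Suc by (simp add: mult.commute)
qed

lemma sum_alpha_customers:
  fixes N :: "('i::finite, 'j) network"
  shows "(\<Sum>(i, s)\<in>customers N j. alpha N j i s) = load N j"
proof -
  have "load N j = (\<Sum>(i, s)\<in>(SIGMA i:UNIV. {1..path_length N i}). alpha N j i s)"
    unfolding load_def by (subst sum.Sigma) auto
  also have "\<dots> = (\<Sum>(i, s)\<in>customers N j. alpha N j i s)"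
    by (rule sum.mono_neutral_right) (auto simp: customers_def alpha_def split: if_splits)
  finally show ?thesis ..
qed

text \<open>Summing over all ways to fill \<open>n\<close> positions with arbitrary customers of the node expands
  the power \<open>load N j ^ n\<close>.\<close>

lemma sum_node_weight_length:
  fixes N :: "('i::finite, 'j) network"
  shows "(\<Sum>xs | set xs \<subseteq> customers N j \<and> length xs = n. node_weight N j xs) = norm_term N j n"
proof -
  have "(\<Sum>xs | set xs \<subseteq> customers N j \<and> length xs = n. node_weight N j xs) =
      (\<Sum>xs | set xs \<subseteq> customers N j \<and> length xs = n. \<Prod>(i, s)\<leftarrow>xs. alpha N j i s) /
      (\<Prod>l=1..n. service_rate N j l)"
    unfolding sum_divide_distrib by (rule sum.cong) (auto simp: node_weight_def)
  then show ?thesis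
    by (simp add: sum_prod_list_length finite_customers sum_alpha_customers norm_term_def)
qed

lemma node_weight_nonneg:
  assumes "open_network N"
  shows "0 \<le> node_weight N j xs"
  using assms unfolding node_weight_def
  by (intro divide_nonneg_nonneg prod_list_nonneg prod_nonneg)
    (auto simp: open_network_def alpha_def less_imp_le)

lemma norm_term_nonneg:
  fixes N :: "('i::finite, 'j::finite) network"
  assumes "open_network N"
  shows "0 \<le> norm_term N j n"
  unfolding sum_node_weight_length[symmetric] using node_weight_nonneg[OF assms] by (intro sum_nonneg)

lemma node_weight_has_sum:
  fixes N :: "('i::finite, 'j::finite) network"
  assumes N: "open_network N" and summable: "summable (norm_term N j)"
  shows "(node_weight N j has_sum (\<Sum>n. norm_term N j n)) {xs. set xs \<subseteq> customers N j}"
proof -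
  let ?L = "\<lambda>n. {xs. set xs \<subseteq> customers N j \<and> length xs = n}"
  have fin: "((\<lambda>xs. node_weight N j (snd (n, xs))) has_sum norm_term N j n) (?L n)" for n
    using has_sum_finite[OF finite_lists_length_eq[OF finite_customers[of N j]], of "node_weight N j" n]
    by (simp add: sum_node_weight_length)
  have g: "(norm_term N j has_sum (\<Sum>n. norm_term N j n)) UNIV"
    using summable by (intro sums_nonneg_imp_has_sum summable_sums norm_term_nonneg[OF N])
  have "((\<lambda>z. node_weight N j (snd z)) has_sum (\<Sum>n. norm_term N j n)) (SIGMA n:UNIV. ?L n)"
    using fin g node_weight_nonneg[OF N]
    by (intro has_sum_SigmaI[OF fin g] summable_on_SigmaI[OF fin has_sum_imp_summable[OF g]]) auto
  moreover have "inj_on snd (SIGMA n:UNIV. ?L n)" by (auto simp: inj_on_def)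
  moreover have "snd ` (SIGMA n:UNIV. ?L n) = {xs. set xs \<subseteq> customers N j}" by force
  ultimately show ?thesis
    using has_sum_reindex[of snd "SIGMA n:UNIV. ?L n" "node_weight N j"] by (simp add: o_def)
qed

lemma weight_single:
  fixes N :: "('i, 'j::finite) network"
  shows "weight N ((\<lambda>_. [])(j := xs)) = node_weight N j xs"
  unfolding weight_def by (subst prod.remove[of _ j]) (auto simp: node_weight_def)

lemma weight_nonneg: "open_network N \<Longrightarrow> 0 \<le> weight N C"
  unfolding weight_def by (intro prod_nonneg node_weight_nonneg) auto

text \<open>The states in which all nodes but \<open>j\<close> are empty already carry the whole series of node
  \<open>j\<close>.\<close>

lemma norm_term_summable:
  fixes N :: "('i::finite, 'j::finite) network"
  assumes N: "open_network N" and summable: "weight N summable_on states N"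
  shows "summable (norm_term N j)"
proof (rule summableI_nonneg_bounded[OF norm_term_nonneg[OF N]])
  fix K
  let ?L = "\<lambda>n. {xs. set xs \<subseteq> customers N j \<and> length xs = n}"
  let ?U = "\<Union>n<K. ?L n"
  let ?e = "\<lambda>xs. (\<lambda>_. [])(j := xs)"
  have fin: "finite ?U" using finite_lists_length_eq[OF finite_customers[of N j]] by auto
  have inj: "inj_on ?e ?U" by (rule inj_onI) (metis fun_upd_same)
  have "(\<Sum>n<K. norm_term N j n) = (\<Sum>n<K. \<Sum>xs\<in>?L n. node_weight N j xs)"
    by (simp add: sum_node_weight_length)
  also have "\<dots> = (\<Sum>xs\<in>?U. node_weight N j xs)"
    using finite_lists_length_eq[OF finite_customers[of N j]]
    by (intro sum.UNION_disjoint[symmetric]) auto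
  also have "\<dots> = (\<Sum>C\<in>?e ` ?U. weight N C)"
    by (simp add: sum.reindex[OF inj] weight_single)
  also have "\<dots> \<le> infsum (weight N) (states N)"
    using fin by (intro finite_sum_le_infsum summable weight_nonneg[OF N]) (auto simp: states_iff)
  finally show "(\<Sum>n<K. norm_term N j n) \<le> infsum (weight N) (states N)" .
qed

lemma infsum_weight:
  fixes N :: "('i::finite, 'j::finite) network"
  assumes N: "open_network N" and summable: "weight N summable_on states N"
  shows "infsum (weight N) (states N) = (\<Prod>j\<in>UNIV. \<Sum>n. norm_term N j n)"
proof -
  let ?B = "\<lambda>j. {xs. set xs \<subseteq> customers N j}"
  have states: "states N = Pi\<^sub>E UNIV ?B"
    unfolding set_eq_iff by (simp add: states_iff PiE_UNIV_domain Pi_iff)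
  have hs: "(node_weight N j has_sum (\<Sum>n. norm_term N j n)) (?B j)" for j
    by (rule node_weight_has_sum[OF N norm_term_summable[OF N summable]])
  have "infsum (weight N) (states N) = (\<Prod>j\<in>UNIV. infsum (node_weight N j) (?B j))"
    using summable unfolding states weight_def[abs_def]
    by (intro infsum_prod_PiE has_sum_imp_summable[OF hs]) auto
  then show ?thesis using infsumI[OF hs] by simp
qed

section \<open>Transitions and their intensities\<close>

definition move_intensity ::
    "('i, 'j) network \<Rightarrow> ('i, 'j) state \<Rightarrow> 'j \<Rightarrow> nat \<Rightarrow> nat \<Rightarrow> real" where
  "move_intensity N C j g h = service_rate N j g * velocity N j (num C j) g *
     entry_prob N (next_node N C j g) (size_after N C j g) h"

definition service_intensity :: "('i, 'j) network \<Rightarrow> ('i, 'j) state \<Rightarrow> 'j \<Rightarrow> nat \<Rightarrow> real" where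
  "service_intensity N C j g = service_rate N j g * velocity N j (num C j) g"

definition enter_intensity :: "('i, 'j) network \<Rightarrow> ('i, 'j) state \<Rightarrow> 'i \<Rightarrow> nat \<Rightarrow> real" where
  "enter_intensity N C i h =
     arrival_rate N i * entry_prob N (route N i 1) (num C (route N i 1) + 1) h"

lemma moves_Sigma: "moves N C j =
    (SIGMA g:{g \<in> {1..num C j}. stage C j g < path_length N (ctype C j g)}. {1..size_after N C j g})"
  by (auto simp: moves_def)

lemma finite_moves: "finite (moves N C j)"
  unfolding moves_Sigma by auto

lemma finite_leaves: "finite (leaves N C j)"
  unfolding leaves_def by auto

lemma finite_enters: "finite (enters N C i)"
  unfolding enters_def by auto

text \<open>A transition rate collects all transitions leading to the same target, so a sum over
  targets is a sum over transitions in which those with a common target keep their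
  multiplicity.\<close>

lemma sum_by_target:
  fixes r :: "'e \<Rightarrow> real"
  assumes "finite E" "finite A" "T ` E \<subseteq> A"
  shows "(\<Sum>D\<in>A. (\<Sum>e\<in>{e\<in>E. T e = D}. r e) * \<phi> D) = (\<Sum>e\<in>E. r e * \<phi> (T e))"
proof -
  have "(\<Sum>D\<in>A. (\<Sum>e\<in>{e\<in>E. T e = D}. r e) * \<phi> D) = (\<Sum>D\<in>A. \<Sum>e\<in>{e\<in>E. T e = D}. r e * \<phi> (T e))"
    by (auto simp: sum_distrib_right intro!: sum.cong)
  then show ?thesis using sum.group[OF assms, of "\<lambda>e. r e * \<phi> (T e)"] by simp
qed

lemma sum_Sigma_Sigma:
  assumes "finite A" "\<And>x. x \<in> A \<Longrightarrow> finite (B x)" "\<And>x y. x \<in> A \<Longrightarrow> y \<in> B x \<Longrightarrow> finite (C x y)"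
  shows "(\<Sum>x\<in>A. \<Sum>y\<in>B x. \<Sum>z\<in>C x y. f x y z) =
    (\<Sum>(x, y, z)\<in>(SIGMA x:A. SIGMA y:B x. C x y). f x y z)"
proof -
  have "(\<Sum>x\<in>A. \<Sum>y\<in>B x. \<Sum>z\<in>C x y. f x y z) = (\<Sum>x\<in>A. \<Sum>(y, z)\<in>(SIGMA y:B x. C x y). f x y z)"
    using assms by (intro sum.cong refl sum.Sigma) auto
  also have "\<dots> = (\<Sum>(x, y, z)\<in>(SIGMA x:A. SIGMA y:B x. C x y). f x y z)"
    using assms by (intro sum.Sigma) auto
  finally show ?thesis .
qed

lemma rate_sum_by_transition:
  fixes C :: "('i::finite, 'j::finite) state"
  assumes A: "finite A"
    and "\<And>j g h. (g, h) \<in> moves N C j \<Longrightarrow> T_move N j g h C \<in> A"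
    and "\<And>j g. g \<in> leaves N C j \<Longrightarrow> T_leave j g C \<in> A"
    and "\<And>i h. h \<in> enters N C i \<Longrightarrow> T_enter N i h C \<in> A"
  shows "(\<Sum>D\<in>A. rate N C D * \<phi> D) =
    (\<Sum>j\<in>UNIV. \<Sum>(g, h)\<in>moves N C j. move_intensity N C j g h * \<phi> (T_move N j g h C)) +
    (\<Sum>j\<in>UNIV. \<Sum>g\<in>leaves N C j. service_intensity N C j g * \<phi> (T_leave j g C)) +
    (\<Sum>i\<in>UNIV. \<Sum>h\<in>enters N C i. enter_intensity N C i h * \<phi> (T_enter N i h C))"
proof -
  have set_eq: "{(g, h) \<in> moves N C j. T_move N j g h C = D} =
      {e \<in> moves N C j. (case e of (g, h) \<Rightarrow> T_move N j g h C) = D}" for j D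
    by auto
  have move: "(\<Sum>D\<in>A. move_rate N C D j * \<phi> D) =
      (\<Sum>(g, h)\<in>moves N C j. move_intensity N C j g h * \<phi> (T_move N j g h C))" for j
    using sum_by_target[OF finite_moves A, of "\<lambda>(g, h). T_move N j g h C" N C j
        "\<lambda>(g, h). move_intensity N C j g h" \<phi>] assms(2)
    unfolding move_rate_def set_eq
    by (simp add: move_intensity_def case_prod_beta image_subset_iff)
  have leave: "(\<Sum>D\<in>A. leave_rate N C D j * \<phi> D) =
      (\<Sum>g\<in>leaves N C j. service_intensity N C j g * \<phi> (T_leave j g C))" for j
    using sum_by_target[OF finite_leaves A, of "\<lambda>g. T_leave j g C" N C j
        "service_intensity N C j" \<phi>] assms(3)
    by (simp add: leave_rate_def service_intensity_def image_subset_iff)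
  have enter: "(\<Sum>D\<in>A. enter_rate N C D i * \<phi> D) =
      (\<Sum>h\<in>enters N C i. enter_intensity N C i h * \<phi> (T_enter N i h C))" for i
    using sum_by_target[OF finite_enters A, of "\<lambda>h. T_enter N i h C" N C i
        "enter_intensity N C i" \<phi>] assms(4)
    by (simp add: enter_rate_def enter_intensity_def image_subset_iff)
  show ?thesis
    unfolding rate_def move[symmetric] leave[symmetric] enter[symmetric]
    by (simp add: distrib_right sum.distrib sum_distrib_right sum.swap[of _ A])
qed

lemma size_after_remove:
  assumes "1 \<le> g" "g \<le> num C j"
  shows "size_after N C j g = num (remove_at j g C) (next_node N C j g) + 1"
  using assms by (auto simp: size_after_def num_remove)

text \<open>A move takes a customer out of a background state \<open>B\<close> and puts it back elsewhere; source
  and target are two insertions into the same \<open>B\<close>, also under feedback, where the numbers of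
  positions available are counted in \<open>B\<close>.\<close>

lemma move_decompose:
  assumes C: "C \<in> states N" and m: "(g, h) \<in> moves N C j"
  defines "B \<equiv> remove_at j g C" and "i \<equiv> ctype C j g" and "s \<equiv> stage C j g"
    and "k \<equiv> next_node N C j g"
  shows "C = insert_at j g (i, s) B" "T_move N j g h C = insert_at k h (i, s + 1) B"
    "1 \<le> g" "g \<le> num B j + 1" "1 \<le> h" "h \<le> num B k + 1" "B \<in> states N"
    "route N i s = j" "route N i (s + 1) = k" "1 \<le> s" "s < path_length N i"
    "num C j = num B j + 1" "size_after N C j g = num B k + 1"
proof -
  have g: "1 \<le> g" "g \<le> num C j" and h: "1 \<le> h" "h \<le> size_after N C j g" and s: "s < path_length N i"
    using m by (auto simp: moves_def i_def s_def)
  show "C = insert_at j g (i, s) B"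
    using insert_remove[of g C j, OF g] by (simp add: B_def i_def s_def ctype_stage)
  show "T_move N j g h C = insert_at k h (i, s + 1) B"
    by (simp add: T_move_def B_def i_def s_def k_def)
  show "B \<in> states N" unfolding B_def by (rule states_remove[OF C])
  show n: "num C j = num B j + 1" using g by (simp add: B_def num_remove)
  show sa: "size_after N C j g = num B k + 1"
    using size_after_remove[of g C j N, OF g] by (simp add: B_def k_def)
  have "(i, s) \<in> customers N j" using customer_at[OF C g] by (simp add: i_def s_def)
  then show "route N i s = j" "1 \<le> s" by (auto simp: customers_def)
  show "route N i (s + 1) = k" by (simp add: k_def next_node_def i_def s_def)
  show "1 \<le> g" "g \<le> num B j + 1" "1 \<le> h" "h \<le> num B k + 1" "s < path_length N i"
    using g h s n sa by auto
qed

lemma leave_decompose: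
  assumes C: "C \<in> states N" and m: "g \<in> leaves N C j"
  defines "B \<equiv> T_leave j g C" and "i \<equiv> ctype C j g"
  shows "C = insert_at j g (i, path_length N i) B" "1 \<le> g" "g \<le> num B j + 1" "B \<in> states N"
    "route N i (path_length N i) = j" "num C j = num B j + 1"
proof -
  have g: "1 \<le> g" "g \<le> num C j" and s: "stage C j g = path_length N i"
    using m by (auto simp: leaves_def i_def)
  show "C = insert_at j g (i, path_length N i) B"
  proof -
    have "(i, path_length N i) = C j ! (g - 1)" by (subst s[symmetric]) (simp only: i_def ctype_stage)
    then show ?thesis using insert_remove[of g C j, OF g] by (simp add: B_def T_leave_def)
  qed
  show "B \<in> states N" unfolding B_def T_leave_def by (rule states_remove[OF C])
  show n: "num C j = num B j + 1" using g by (simp add: B_def T_leave_def num_remove)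
  show "route N i (path_length N i) = j"
    using node_eq[OF C, of g j] g s by (simp add: i_def)
  show "1 \<le> g" "g \<le> num B j + 1" using g n by auto
qed

lemma position_decompose:
  assumes D: "D \<in> states N" and r: "1 \<le> r" "r \<le> num D k"
  defines "B \<equiv> remove_at k r D" and "i \<equiv> ctype D k r" and "s \<equiv> stage D k r"
  shows "D = insert_at k r (i, s) B" "B \<in> states N" "route N i s = k" "1 \<le> s"
    "s \<le> path_length N i" "num D k = num B k + 1"
proof -
  show "D = insert_at k r (i, s) B"
    using insert_remove[of r D k, OF r] by (simp add: B_def i_def s_def ctype_stage)
  show "B \<in> states N" unfolding B_def by (rule states_remove[OF D])
  show "num D k = num B k + 1" using r by (simp add: B_def num_remove)
  have "(i, s) \<in> customers N k" using customer_at[OF D r] by (simp add: i_def s_def)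
  then show "route N i s = k" "1 \<le> s" "s \<le> path_length N i" by (auto simp: customers_def)
qed

lemma customer_insert:
  assumes "1 \<le> r" "r \<le> num B k + 1"
  shows "ctype (insert_at k r c B) k r = fst c" "stage (insert_at k r c B) k r = snd c"
  using nth_insert[of r B k, OF assms] by (simp_all add: ctype_def stage_def)

locale balanced_network =
  fixes N :: "('i::finite, 'j::finite) network"
  assumes network: "open_network N"
    and total_rate: "n \<ge> 1 \<Longrightarrow>
      (\<Sum>l=1..n. service_rate N j l * velocity N j n l) = service_rate N j n"
begin

lemma arrival_pos: "0 < arrival_rate N i"
  and path_pos: "1 \<le> path_length N i"
  and service_pos: "1 \<le> l \<Longrightarrow> 0 < service_rate N j l"
  and velocity_nonneg: "1 \<le> l \<Longrightarrow> l \<le> n \<Longrightarrow> 0 \<le> velocity N j n l"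
  and entry_nonneg: "1 \<le> l \<Longrightarrow> l \<le> n \<Longrightarrow> 0 \<le> entry_prob N j n l"
  and entry_sum: "1 \<le> n \<Longrightarrow> (\<Sum>l=1..n. entry_prob N j n l) = 1"
  using network by (auto simp: open_network_def)

lemma move_target:
  assumes "C \<in> states N" "(g, h) \<in> moves N C j"
  shows "T_move N j g h C \<in> states N"
  using move_decompose[OF assms] by (simp add: states_insert customers_def)

lemma leave_target: "C \<in> states N \<Longrightarrow> T_leave j g C \<in> states N"
  unfolding T_leave_def by (rule states_remove)

lemma enter_target: "C \<in> states N \<Longrightarrow> h \<in> enters N C i \<Longrightarrow> T_enter N i h C \<in> states N"
  unfolding T_enter_def enters_def using path_pos[of i] by (simp add: states_insert customers_def)

lemma move_intensity_nonneg: "(g, h) \<in> moves N C j \<Longrightarrow> 0 \<le> move_intensity N C j g h"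
  by (auto simp: move_intensity_def moves_def intro!: mult_nonneg_nonneg velocity_nonneg entry_nonneg
      less_imp_le[OF service_pos])

lemma service_intensity_nonneg: "g \<in> leaves N C j \<Longrightarrow> 0 \<le> service_intensity N C j g"
  by (auto simp: service_intensity_def leaves_def intro!: mult_nonneg_nonneg velocity_nonneg
      less_imp_le[OF service_pos])

lemma enter_intensity_nonneg: "h \<in> enters N C i \<Longrightarrow> 0 \<le> enter_intensity N C i h"
  by (auto simp: enter_intensity_def enters_def intro!: mult_nonneg_nonneg entry_nonneg
      less_imp_le[OF arrival_pos])

lemma enter_total: "(\<Sum>h\<in>enters N C i. enter_intensity N C i h) = arrival_rate N i"
  using entry_sum[of "num C (route N i 1) + 1" "route N i 1"]
  by (simp add: enter_intensity_def enters_def sum_distrib_left[symmetric])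

text \<open>Summing over the entry positions removes the entry probabilities, and every customer in
  service either moves on or leaves.\<close>

lemma service_total:
  assumes C: "C \<in> states N"
  shows "(\<Sum>(g, h)\<in>moves N C j. move_intensity N C j g h) + (\<Sum>g\<in>leaves N C j. service_intensity N C j g) =
    (\<Sum>g=1..num C j. service_intensity N C j g)"
proof -
  let ?G = "{g \<in> {1..num C j}. stage C j g < path_length N (ctype C j g)}"
  have "(\<Sum>(g, h)\<in>moves N C j. move_intensity N C j g h) =
      (\<Sum>g\<in>?G. \<Sum>h=1..size_after N C j g. move_intensity N C j g h)"
    unfolding moves_Sigma by (subst sum.Sigma) auto
  also have "\<dots> = (\<Sum>g\<in>?G. service_intensity N C j g)"
  proof (rule sum.cong[OF refl])
    fix g assume "g \<in> ?G"
    then have "1 \<le> size_after N C j g" using size_after_remove[of g C j N] by auto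
    then show "(\<Sum>h=1..size_after N C j g. move_intensity N C j g h) = service_intensity N C j g"
      using entry_sum[of "size_after N C j g" "next_node N C j g"]
      by (simp add: move_intensity_def service_intensity_def sum_distrib_left[symmetric])
  qed
  finally have "(\<Sum>(g, h)\<in>moves N C j. move_intensity N C j g h) = (\<Sum>g\<in>?G. service_intensity N C j g)" .
  moreover have "(\<Sum>g=1..num C j. service_intensity N C j g) =
      (\<Sum>g\<in>?G. service_intensity N C j g) + (\<Sum>g\<in>leaves N C j. service_intensity N C j g)"
  proof -
    have "{1..num C j} = ?G \<union> leaves N C j"
      using customer_at[OF C] by (fastforce simp: leaves_def customers_def)
    then have "(\<Sum>g=1..num C j. service_intensity N C j g) = (\<Sum>g\<in>?G \<union> leaves N C j. service_intensity N C j g)"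
      by (rule arg_cong)
    also have "\<dots> = (\<Sum>g\<in>?G. service_intensity N C j g) + (\<Sum>g\<in>leaves N C j. service_intensity N C j g)"
      by (rule sum.union_disjoint) (auto simp: leaves_def)
    finally show ?thesis .
  qed
  ultimately show ?thesis by (simp only:)
qed

text \<open>The total rate out of \<open>C\<close>, once the assumption \<open>total_rate\<close> has turned the service
  completions at node \<open>j\<close> into the single rate \<open>service_rate N j (num C j)\<close>.\<close>

definition exit_total :: "('i, 'j) state \<Rightarrow> real" where
  "exit_total C = (\<Sum>j\<in>UNIV. if num C j = 0 then 0 else service_rate N j (num C j)) +
    (\<Sum>i\<in>UNIV. arrival_rate N i)"

lemma service_total_eq:
  "(\<Sum>g=1..num C j. service_intensity N C j g) = (if num C j = 0 then 0 else service_rate N j (num C j))"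
  using total_rate[of "num C j" j] by (cases "num C j") (simp_all add: service_intensity_def)

lemma outflow:
  assumes C: "C \<in> states N" and A: "finite A"
    and "\<And>j g h. (g, h) \<in> moves N C j \<Longrightarrow> T_move N j g h C \<in> A"
    and "\<And>j g. g \<in> leaves N C j \<Longrightarrow> T_leave j g C \<in> A"
    and "\<And>i h. h \<in> enters N C i \<Longrightarrow> T_enter N i h C \<in> A"
  shows "(\<Sum>D\<in>A. rate N C D) = exit_total C"
  using rate_sum_by_transition[OF A, of N C "\<lambda>_. 1"] assms(3-5)
    service_total[OF C] service_total_eq[of C] enter_total[of C]
  by (simp add: exit_total_def sum.distrib[symmetric])

section \<open>Partial balance\<close>

lemma weight_remove:
  assumes "D \<in> states N" "1 \<le> r" "r \<le> num D k"
  shows "weight N (remove_at k r D) * arrival_rate N (ctype D k r) =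
    weight N D * service_rate N k (num D k)"
  using position_decompose[OF assms] weight_insert[of N "ctype D k r" "stage D k r" k r "remove_at k r D"]
    service_pos[of "num D k" k]
  by simp

text \<open>Each customer of \<open>D\<close> at stage 1 may be the one that has just entered. Removing it
  divides the weight by \<open>arrival_rate / service_rate\<close>, with the service rate of the full node,
  and its entrance restores the arrival rate.\<close>

lemma enter_inflow:
  assumes D: "D \<in> states N" and A: "finite A" "A \<subseteq> states N"
    and pred: "\<And>C. C \<in> states N \<Longrightarrow> work N C \<le> work N D + 1 \<Longrightarrow> C \<in> A"
  shows "(\<Sum>C\<in>A. weight N C * (\<Sum>i\<in>UNIV. enter_rate N C D i)) =
    (\<Sum>k\<in>UNIV. \<Sum>r\<in>{r\<in>{1..num D k}. stage D k r = 1}.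
      weight N D * service_rate N k (num D k) * entry_prob N k (num D k) r)"
proof -
  let ?S = "SIGMA C:A. SIGMA i:UNIV. {h \<in> enters N C i. T_enter N i h C = D}"
  let ?T = "SIGMA k:UNIV. {r\<in>{1..num D k}. stage D k r = 1}"
  have "(\<Sum>C\<in>A. weight N C * (\<Sum>i\<in>UNIV. enter_rate N C D i)) =
      (\<Sum>C\<in>A. \<Sum>i\<in>UNIV. \<Sum>h\<in>{h \<in> enters N C i. T_enter N i h C = D}. weight N C * enter_intensity N C i h)"
    by (simp add: enter_rate_def enter_intensity_def sum_distrib_left)
  also have "\<dots> = (\<Sum>(C, i, h)\<in>?S. weight N C * enter_intensity N C i h)"
    using A by (intro sum_Sigma_Sigma) (auto intro: finite_subset[OF _ finite_enters])
  also have "\<dots> = (\<Sum>(k, r)\<in>?T. weight N D * service_rate N k (num D k) * entry_prob N k (num D k) r)"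
  proof (rule sum.reindex_bij_witness[where j = "\<lambda>(C, i, h). (route N i 1, h)"
        and i = "\<lambda>(k, r). (remove_at k r D, ctype D k r, r)"])
    fix a assume "a \<in> ?S"
    then obtain C i h where a: "a = (C, i, h)" and C: "C \<in> A" and h: "1 \<le> h" "h \<le> num C (route N i 1) + 1"
      and T: "T_enter N i h C = D" by (auto simp: enters_def)
    let ?k = "route N i 1"
    have ins: "D = insert_at ?k h (i, 1) C" using T by (simp add: T_enter_def)
    have rem: "remove_at ?k h D = C" using remove_insert[of h C ?k, OF h] by (simp add: ins)
    have it: "ctype D ?k h = i" "stage D ?k h = 1" using customer_insert[of h C ?k, OF h] by (simp_all add: ins)
    have n: "num D ?k = num C ?k + 1" by (simp add: ins num_insert)
    show "(case (case a of (C, i, h) \<Rightarrow> (route N i 1, h)) of (k, r) \<Rightarrow> (remove_at k r D, ctype D k r, r)) = a"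
      using rem it by (simp add: a)
    show "(case a of (C, i, h) \<Rightarrow> (route N i 1, h)) \<in> ?T" using h n it by (simp add: a)
    have "weight N C * arrival_rate N i = weight N D * service_rate N ?k (num D ?k)"
      using weight_remove[OF D h(1), of ?k] h(2) n rem it by simp
    then show "(case (case a of (C, i, h) \<Rightarrow> (route N i 1, h)) of (k, r) \<Rightarrow>
        weight N D * service_rate N k (num D k) * entry_prob N k (num D k) r) =
        (case a of (C, i, h) \<Rightarrow> weight N C * enter_intensity N C i h)"
      using n by (simp add: a enter_intensity_def)
  next
    fix b assume "b \<in> ?T"
    then obtain k r where b: "b = (k, r)" and r: "1 \<le> r" "r \<le> num D k" and s: "stage D k r = 1" by auto
    note p = position_decompose[OF D r]
    have route: "route N (ctype D k r) 1 = k" using p(3) s by simp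
    have T: "T_enter N (ctype D k r) r (remove_at k r D) = D"
      using p(1) s route by (simp add: T_enter_def)
    show "(case (case b of (k, r) \<Rightarrow> (remove_at k r D, ctype D k r, r)) of (C, i, h) \<Rightarrow> (route N i 1, h)) = b"
      using route by (simp add: b)
    have "remove_at k r D \<in> A"
      using pred[OF p(2)] work_enter[of N "ctype D k r" r "remove_at k r D"] T by simp
    then show "(case b of (k, r) \<Rightarrow> (remove_at k r D, ctype D k r, r)) \<in> ?S"
      using T route p(6) r by (simp add: b enters_def)
  qed
  also have "\<dots> = (\<Sum>k\<in>UNIV. \<Sum>r\<in>{r\<in>{1..num D k}. stage D k r = 1}.
      weight N D * service_rate N k (num D k) * entry_prob N k (num D k) r)"
    by (subst sum.Sigma) auto
  finally show ?thesis .
qed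

text \<open>A predecessor of \<open>D\<close> by a departure has an additional customer of some type at its last
  stage, in any position \<open>l\<close> of its last node. The weight contributes the service rate of the
  enlarged node in the denominator, and this is cancelled by the sum over \<open>l\<close>.\<close>

lemma leave_inflow:
  assumes D: "D \<in> states N" and A: "finite A" "A \<subseteq> states N"
    and pred: "\<And>C. C \<in> states N \<Longrightarrow> work N C \<le> work N D + 1 \<Longrightarrow> C \<in> A"
  shows "(\<Sum>C\<in>A. weight N C * (\<Sum>j\<in>UNIV. leave_rate N C D j)) = weight N D * (\<Sum>i\<in>UNIV. arrival_rate N i)"
proof -
  define exit_node where "exit_node i = route N i (path_length N i)" for i
  let ?S = "SIGMA C:A. SIGMA j:UNIV. {g \<in> leaves N C j. T_leave j g C = D}"
  let ?T = "SIGMA i:UNIV. {1..num D (exit_node i) + 1}"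
  let ?f = "\<lambda>i l. weight N D * arrival_rate N i / service_rate N (exit_node i) (num D (exit_node i) + 1) *
      (service_rate N (exit_node i) l * velocity N (exit_node i) (num D (exit_node i) + 1) l)"
  have "(\<Sum>C\<in>A. weight N C * (\<Sum>j\<in>UNIV. leave_rate N C D j)) =
      (\<Sum>C\<in>A. \<Sum>j\<in>UNIV. \<Sum>g\<in>{g \<in> leaves N C j. T_leave j g C = D}. weight N C * service_intensity N C j g)"
    by (simp add: leave_rate_def service_intensity_def sum_distrib_left)
  also have "\<dots> = (\<Sum>(C, j, g)\<in>?S. weight N C * service_intensity N C j g)"
    using A by (intro sum_Sigma_Sigma) (auto intro: finite_subset[OF _ finite_leaves])
  also have "\<dots> = (\<Sum>(i, l)\<in>?T. ?f i l)"
  proof (rule sum.reindex_bij_witness[where j = "\<lambda>(C, j, g). (ctype C j g, g)"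
        and i = "\<lambda>(i, l). (insert_at (exit_node i) l (i, path_length N i) D, exit_node i, l)"])
    fix a assume "a \<in> ?S"
    then obtain C j g where a: "a = (C, j, g)" and C: "C \<in> states N" and g: "g \<in> leaves N C j"
      and T: "T_leave j g C = D" using A by auto
    note d = leave_decompose[OF C g, unfolded T]
    have j: "exit_node (ctype C j g) = j" using d(5) by (simp add: exit_node_def)
    show "(case (case a of (C, j, g) \<Rightarrow> (ctype C j g, g)) of (i, l) \<Rightarrow>
        (insert_at (exit_node i) l (i, path_length N i) D, exit_node i, l)) = a"
      using d(1) j by (simp add: a)
    show "(case a of (C, j, g) \<Rightarrow> (ctype C j g, g)) \<in> ?T" using d(2,3) j by (simp add: a)
    have "weight N C = weight N D * arrival_rate N (ctype C j g) / service_rate N j (num D j + 1)"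
      using weight_insert[OF d(5), of g D] d(1) by simp
    then show "(case (case a of (C, j, g) \<Rightarrow> (ctype C j g, g)) of (i, l) \<Rightarrow> ?f i l) =
        (case a of (C, j, g) \<Rightarrow> weight N C * service_intensity N C j g)"
      using d(6) j by (simp add: a service_intensity_def)
  next
    fix b assume "b \<in> ?T"
    then obtain i l where b: "b = (i, l)" and l: "1 \<le> l" "l \<le> num D (exit_node i) + 1" by auto
    let ?C = "insert_at (exit_node i) l (i, path_length N i) D"
    have C: "?C \<in> states N"
      using D l path_pos[of i] by (simp add: states_insert customers_def exit_node_def)
    have it: "ctype ?C (exit_node i) l = i" "stage ?C (exit_node i) l = path_length N i"
      using customer_insert[of l D "exit_node i", OF l] by simp_all
    have T: "T_leave (exit_node i) l ?C = D" unfolding T_leave_def by (rule remove_insert[of l D "exit_node i", OF l])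
    have g: "l \<in> leaves N ?C (exit_node i)" using l it by (simp add: leaves_def num_insert)
    show "(case (case b of (i, l) \<Rightarrow> (insert_at (exit_node i) l (i, path_length N i) D, exit_node i, l)) of
        (C, j, g) \<Rightarrow> (ctype C j g, g)) = b" using it by (simp add: b)
    have "?C \<in> A" using pred[OF C] work_leave[OF g] T by simp
    then show "(case b of (i, l) \<Rightarrow> (insert_at (exit_node i) l (i, path_length N i) D, exit_node i, l)) \<in> ?S"
      using g T by (simp add: b)
  qed
  also have "\<dots> = (\<Sum>i\<in>UNIV. \<Sum>l=1..num D (exit_node i) + 1. ?f i l)"
    by (subst sum.Sigma) auto
  also have "\<dots> = (\<Sum>i\<in>UNIV. weight N D * arrival_rate N i)"
  proof (rule sum.cong[OF refl])
    fix i
    show "(\<Sum>l=1..num D (exit_node i) + 1. ?f i l) = weight N D * arrival_rate N i"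
      unfolding sum_distrib_left[symmetric] using total_rate[of "num D (exit_node i) + 1" "exit_node i"]
        service_pos[of "num D (exit_node i) + 1" "exit_node i"] by simp
  qed
  finally show ?thesis by (simp add: sum_distrib_left)
qed

text \<open>Each customer of \<open>D\<close> past stage 1 may be the one that has just moved. It came from the
  previous node of its path, from any position \<open>l\<close>. As for departures, the sum over \<open>l\<close> cancels
  the service rate of that node, and what is left per customer has the same form as in
  \<open>enter_inflow\<close>: stage 1 and the later stages become indistinguishable.\<close>

lemma move_inflow:
  assumes D: "D \<in> states N" and A: "finite A" "A \<subseteq> states N"
    and pred: "\<And>C. C \<in> states N \<Longrightarrow> work N C \<le> work N D + 1 \<Longrightarrow> C \<in> A"
  shows "(\<Sum>C\<in>A. weight N C * (\<Sum>j\<in>UNIV. move_rate N C D j)) =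
    (\<Sum>k\<in>UNIV. \<Sum>r\<in>{r\<in>{1..num D k}. stage D k r \<noteq> 1}.
      weight N D * service_rate N k (num D k) * entry_prob N k (num D k) r)"
proof -
  define prev where "prev k r = route N (ctype D k r) (stage D k r - 1)" for k r
  define source_size where "source_size k r = num (remove_at k r D) (prev k r) + 1" for k r
  let ?S = "SIGMA C:A. SIGMA j:UNIV. {(g, h) \<in> moves N C j. T_move N j g h C = D}"
  let ?R = "\<lambda>k. {r\<in>{1..num D k}. stage D k r \<noteq> 1}"
  let ?T = "SIGMA k:UNIV. SIGMA r:?R k. {1..source_size k r}"
  let ?f = "\<lambda>k r. weight N D * service_rate N k (num D k) * entry_prob N k (num D k) r"
  let ?g = "\<lambda>k r l. ?f k r / service_rate N (prev k r) (source_size k r) *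
      (service_rate N (prev k r) l * velocity N (prev k r) (source_size k r) l)"
  \<comment> \<open>A predecessor is given by the position \<open>(k, r)\<close> in \<open>D\<close> of the customer that moved and its
    earlier position \<open>l\<close>; the node it came from is \<open>prev k r\<close>.\<close>
  let ?back = "\<lambda>(k, r, l). (insert_at (prev k r) l (ctype D k r, stage D k r - 1) (remove_at k r D),
      prev k r, l, r)"
  let ?forth = "\<lambda>(C, j, g, h). (next_node N C j g, h, g)"
  have "(\<Sum>C\<in>A. weight N C * (\<Sum>j\<in>UNIV. move_rate N C D j)) =
      (\<Sum>C\<in>A. \<Sum>j\<in>UNIV. \<Sum>(g, h)\<in>{(g, h) \<in> moves N C j. T_move N j g h C = D}.
        weight N C * move_intensity N C j g h)"
    by (simp add: move_rate_def move_intensity_def sum_distrib_left case_prod_beta)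
  also have "\<dots> = (\<Sum>(C, j, g, h)\<in>?S. weight N C * move_intensity N C j g h)"
    using A finite_moves
    by (intro trans[OF sum_Sigma_Sigma]) (auto intro: finite_subset[OF _ finite_moves] simp: case_prod_beta)
  also have "\<dots> = (\<Sum>(k, r, l)\<in>?T. ?g k r l)"
  proof (rule sum.reindex_bij_witness[where j = ?forth and i = ?back])
    fix a assume "a \<in> ?S"
    then obtain C j g h where a: "a = (C, j, g, h)" and C: "C \<in> states N" and m: "(g, h) \<in> moves N C j"
      and T: "T_move N j g h C = D" using A by auto
    define k where "k = next_node N C j g"
    define i where "i = ctype C j g"
    define s where "s = stage C j g"
    define B where "B = remove_at j g C"
    note d = move_decompose[OF C m, folded B_def i_def s_def k_def, unfolded T]
    have rem: "remove_at k h D = B" unfolding d(2) by (rule remove_insert[of h B k, OF d(5,6)])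
    have it: "ctype D k h = i" "stage D k h = s + 1"
      using customer_insert[of h B k, OF d(5,6)] by (simp_all add: d(2))
    have n: "num D k = num B k + 1" by (simp add: d(2) num_insert)
    have pr: "prev k h = j" using d(8) by (simp add: prev_def it)
    have sz: "source_size k h = num B j + 1" by (simp add: source_size_def pr rem)
    show "?back (?forth a) = a" using d(1)[symmetric] pr it rem by (simp add: a k_def[symmetric])
    show "?forth a \<in> ?T" using d(3-6,10) it n sz by (simp add: a k_def[symmetric])
    have "weight N C = weight N B * arrival_rate N i / service_rate N j (num B j + 1)"
      using weight_insert[OF d(8), of g B] d(1) by simp
    moreover have "weight N B * arrival_rate N i = weight N D * service_rate N k (num D k)"
      using weight_remove[OF D d(5), of k] d(6) n rem it by simp
    ultimately show "(case ?forth a of (k, r, l) \<Rightarrow> ?g k r l) =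
        (case a of (C, j, g, h) \<Rightarrow> weight N C * move_intensity N C j g h)"
      using pr sz n d(12,13) by (simp add: a k_def[symmetric] move_intensity_def)
  next
    fix b assume "b \<in> ?T"
    then obtain k r l where b: "b = (k, r, l)" and r: "1 \<le> r" "r \<le> num D k"
      and s1: "stage D k r \<noteq> 1" and l: "1 \<le> l" "l \<le> source_size k r" by auto
    define B where "B = remove_at k r D"
    define i where "i = ctype D k r"
    define s where "s = stage D k r - 1"
    define j where "j = prev k r"
    note p = position_decompose[OF D r, folded B_def i_def]
    have s: "stage D k r = s + 1" "1 \<le> s" using p(4) s1 by (auto simp: s_def)
    let ?C = "insert_at j l (i, s) B"
    have l': "l \<le> num B j + 1" using l(2) by (simp add: source_size_def B_def j_def)
    have "route N i s = j" by (simp add: j_def prev_def i_def s_def)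
    then have C: "?C \<in> states N"
      using p(2,5) l s by (simp add: states_insert customers_def)
    have it: "ctype ?C j l = i" "stage ?C j l = s"
      using customer_insert[of l B j, OF l(1) l'] by simp_all
    have nxt: "next_node N ?C j l = k" using p(3) s by (simp add: next_node_def it)
    have rem: "remove_at j l ?C = B" by (rule remove_insert[of l B j, OF l(1) l'])
    have T: "T_move N j l r ?C = D"
      using p(1) s by (simp add: T_move_def nxt rem it)
    have m: "(l, r) \<in> moves N ?C j"
      using l l' p r s size_after_remove[of l ?C j N] nxt rem it
      by (simp add: moves_def num_insert)
    have backward: "?back b = (?C, j, l, r)" by (simp add: b j_def i_def s_def B_def)
    show "?forth (?back b) = b" unfolding backward using nxt by (simp add: b)
    have "?C \<in> A" using pred[OF C] work_move[OF m] T by simp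
    then show "?back b \<in> ?S" unfolding backward using m T by simp
  qed
  also have "\<dots> = (\<Sum>k\<in>UNIV. \<Sum>r\<in>?R k. \<Sum>l=1..source_size k r. ?g k r l)"
    by (rule sum_Sigma_Sigma[symmetric]) auto
  also have "\<dots> = (\<Sum>k\<in>UNIV. \<Sum>r\<in>?R k. ?f k r)"
  proof (intro sum.cong refl)
    fix k r
    have "1 \<le> source_size k r" by (simp add: source_size_def)
    then show "(\<Sum>l=1..source_size k r. ?g k r l) = ?f k r"
      unfolding sum_distrib_left[symmetric] using total_rate service_pos[of "source_size k r" "prev k r"]
      by simp
  qed
  finally show ?thesis .
qed

text \<open>The inflow by entrances and moves balances the outflow by services at each node, because
  the entry probabilities sum to 1; the inflow by departures balances the outflow by arrivals.\<close>

lemma global_balance: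
  assumes D: "D \<in> states N" and A: "finite A" "A \<subseteq> states N"
    and pred: "\<And>C. C \<in> states N \<Longrightarrow> work N C \<le> work N D + 1 \<Longrightarrow> C \<in> A"
  shows "(\<Sum>C\<in>A. weight N C * rate N C D) = weight N D * exit_total D"
proof -
  let ?f = "\<lambda>k r. weight N D * service_rate N k (num D k) * entry_prob N k (num D k) r"
  have "(\<Sum>r\<in>{r\<in>{1..num D k}. stage D k r \<noteq> 1}. ?f k r) + (\<Sum>r\<in>{r\<in>{1..num D k}. stage D k r = 1}. ?f k r) =
      weight N D * (if num D k = 0 then 0 else service_rate N k (num D k))" for k
  proof -
    have "(\<Sum>r\<in>{r\<in>{1..num D k}. stage D k r \<noteq> 1}. ?f k r) + (\<Sum>r\<in>{r\<in>{1..num D k}. stage D k r = 1}. ?f k r)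
        = (\<Sum>r=1..num D k. ?f k r)"
      by (subst sum.union_disjoint[symmetric]) (auto intro!: sum.cong)
    then show ?thesis
      using entry_sum[of "num D k" k] by (cases "num D k") (auto simp: sum_distrib_left[symmetric])
  qed
  then have "(\<Sum>k\<in>UNIV. \<Sum>r\<in>{r\<in>{1..num D k}. stage D k r \<noteq> 1}. ?f k r) +
      (\<Sum>k\<in>UNIV. \<Sum>r\<in>{r\<in>{1..num D k}. stage D k r = 1}. ?f k r) =
      weight N D * (\<Sum>k\<in>UNIV. if num D k = 0 then 0 else service_rate N k (num D k))"
    by (simp add: sum.distrib[symmetric] sum_distrib_left)
  moreover have "(\<Sum>C\<in>A. weight N C * rate N C D) =
      (\<Sum>C\<in>A. weight N C * (\<Sum>j\<in>UNIV. move_rate N C D j)) +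
      (\<Sum>C\<in>A. weight N C * (\<Sum>j\<in>UNIV. leave_rate N C D j)) +
      (\<Sum>C\<in>A. weight N C * (\<Sum>i\<in>UNIV. enter_rate N C D i))"
    by (simp add: rate_def distrib_left sum.distrib)
  ultimately show ?thesis
    using move_inflow[OF assms] leave_inflow[OF assms] enter_inflow[OF assms]
    by (simp add: exit_total_def distrib_left)
qed

end

section \<open>The network as a chain with bounded drift\<close>

context balanced_network
begin

definition mean_work_input :: real where
  "mean_work_input = (\<Sum>i\<in>UNIV. arrival_rate N i * real (path_length N i))"

text \<open>An arrival raises the work by the length of a path, any other transition lowers it by 1.\<close>

definition max_jump :: nat where
  "max_jump = 1 + (\<Sum>i\<in>UNIV. path_length N i)"

lemma path_length_less_max_jump: "path_length N i < max_jump"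
  unfolding max_jump_def using member_le_sum[of i UNIV "path_length N"] by simp

lemma rate_nonneg: "0 \<le> rate N C D"
proof -
  have "0 \<le> move_rate N C D j" for j
    unfolding move_rate_def move_intensity_def[symmetric]
    by (intro sum_nonneg) (auto intro: move_intensity_nonneg)
  moreover have "0 \<le> leave_rate N C D j" for j
    unfolding leave_rate_def service_intensity_def[symmetric]
    by (intro sum_nonneg) (auto intro: service_intensity_nonneg)
  moreover have "0 \<le> enter_rate N C D i" for i
    unfolding enter_rate_def enter_intensity_def[symmetric]
    by (intro sum_nonneg) (auto intro: enter_intensity_nonneg)
  ultimately show ?thesis unfolding rate_def by (intro add_nonneg_nonneg sum_nonneg)
qed

lemma rate_nonzero_cases:
  assumes "rate N C D \<noteq> 0"
  obtains (move) j g h where "(g, h) \<in> moves N C j" "D = T_move N j g h C"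
  | (leave) j g where "g \<in> leaves N C j" "D = T_leave j g C"
  | (enter) i h where "h \<in> enters N C i" "D = T_enter N i h C"
proof (rule ccontr)
  assume *: "\<not> thesis"
  have "move_rate N C D j = 0" for j using * move by (intro move_rate_eq_0) auto
  moreover have "leave_rate N C D j = 0" for j using * leave by (intro leave_rate_eq_0) auto
  moreover have "enter_rate N C D i = 0" for i using * enter by (intro enter_rate_eq_0) auto
  ultimately show False using assms by (simp add: rate_def)
qed

lemma rate_work:
  assumes "rate N C D \<noteq> 0"
  shows "work N D \<le> work N C + max_jump \<and> work N C \<le> work N D + 1 \<and> work N D \<noteq> work N C"
  using assms
proof (cases rule: rate_nonzero_cases)
  case (move j g h)
  then show ?thesis using work_move[OF move(1)] by simp
next
  case (leave j g)
  then show ?thesis using work_leave[OF leave(1)] by simp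
next
  case (enter i h)
  then show ?thesis using work_enter[of N i h C] path_pos[of i] path_length_less_max_jump[of i] by simp
qed

definition reach :: "('i, 'j) state \<Rightarrow> ('i, 'j) state set" where
  "reach C = {D \<in> states N. work N D \<le> work N C + max_jump}"

lemma finite_reach: "finite (reach C)"
  unfolding reach_def by (rule finite_work_level)

lemma targets_reach:
  assumes "C \<in> states N"
  shows "(g, h) \<in> moves N C j \<Longrightarrow> T_move N j g h C \<in> reach C"
    and "g \<in> leaves N C j \<Longrightarrow> T_leave j g C \<in> reach C"
    and "h \<in> enters N C i \<Longrightarrow> T_enter N i h C \<in> reach C"
  using move_target[OF assms, of g h j] leave_target[OF assms, of j g] enter_target[OF assms, of h i]
    work_move[of g h N C j] work_leave[of g N C j] work_enter[of N i h C] path_length_less_max_jump[of i]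
  by (auto simp: reach_def)

lemma work_drift:
  assumes C: "C \<in> states N"
  shows "(\<Sum>D\<in>reach C. rate N C D * (real (work N D) - real (work N C))) \<le> mean_work_input"
proof -
  let ?\<phi> = "\<lambda>D. real (work N D) - real (work N C)"
  have "(\<Sum>(g, h)\<in>moves N C j. move_intensity N C j g h * ?\<phi> (T_move N j g h C)) \<le> 0" for j
    using work_move[of _ _ N C j] move_intensity_nonneg[of _ _ C j]
    by (intro sum_nonpos) (force simp: mult_nonneg_nonpos)
  then have m: "(\<Sum>j\<in>UNIV. \<Sum>(g, h)\<in>moves N C j. move_intensity N C j g h * ?\<phi> (T_move N j g h C)) \<le> 0"
    by (rule sum_nonpos)
  have "(\<Sum>g\<in>leaves N C j. service_intensity N C j g * ?\<phi> (T_leave j g C)) \<le> 0" for j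
    using work_leave[of _ N C j] service_intensity_nonneg[of _ C j]
    by (intro sum_nonpos) (force simp: mult_nonneg_nonpos)
  then have l: "(\<Sum>j\<in>UNIV. \<Sum>g\<in>leaves N C j. service_intensity N C j g * ?\<phi> (T_leave j g C)) \<le> 0"
    by (rule sum_nonpos)
  have e: "(\<Sum>h\<in>enters N C i. enter_intensity N C i h * ?\<phi> (T_enter N i h C)) =
      arrival_rate N i * real (path_length N i)" for i
    by (simp add: work_enter sum_distrib_right[symmetric] enter_total)
  show ?thesis
    using m l rate_sum_by_transition[OF finite_reach targets_reach[OF C], of ?\<phi>]
    by (simp add: e mean_work_input_def)
qed

text \<open>Velocities and entry probabilities may vanish, so a particular customer may be unable to
  move. But the total service rate of a nonempty node is positive, hence some customer is
  served and, if it goes on, some position at its next node accepts it.\<close>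

lemma work_descends:
  assumes C: "C \<in> states N" and ne: "C \<noteq> (\<lambda>_. [])"
  shows "\<exists>D\<in>states N. 0 < rate N C D \<and> work N D < work N C"
proof -
  obtain j where j: "num C j \<noteq> 0" using ne by fastforce
  have "(\<Sum>g=1..num C j. service_intensity N C j g) > 0"
    unfolding service_total_eq using j service_pos[of "num C j" j] by (cases "num C j") simp_all
  then obtain g where g: "1 \<le> g" "g \<le> num C j" "0 < service_intensity N C j g"
    by (metis (no_types, lifting) atLeastAtMost_iff not_less sum_nonpos)
  show ?thesis
  proof (cases "stage C j g = path_length N (ctype C j g)")
    case True
    then have l: "g \<in> leaves N C j" using g by (simp add: leaves_def)
    have "service_intensity N C j g \<le> leave_rate N C (T_leave j g C) j"
      unfolding leave_rate_def service_intensity_def[symmetric]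
      using l by (intro member_le_sum)
        (auto intro: service_intensity_nonneg finite_subset[OF _ finite_leaves[of N C j]])
    then have "0 < rate N C (T_leave j g C)" using rate_leave[OF C l] g(3) by simp
    then show ?thesis using leave_target[OF C] work_leave[OF l] by force
  next
    case False
    then have s: "stage C j g < path_length N (ctype C j g)"
      using customer_at[OF C g(1,2)] by (simp add: customers_def)
    let ?n = "size_after N C j g" and ?k = "next_node N C j g"
    have "(\<Sum>h=1..?n. entry_prob N ?k ?n h) > 0"
      using entry_sum[of ?n ?k] size_after_remove[of g C j N] g by simp
    then obtain h where h: "1 \<le> h" "h \<le> ?n" "0 < entry_prob N ?k ?n h"
      by (metis (no_types, lifting) atLeastAtMost_iff not_less sum_nonpos)
    have m: "(g, h) \<in> moves N C j" using g h s by (simp add: moves_def)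
    have "move_intensity N C j g h =
        (\<Sum>(g, h)\<in>{(g, h)}. move_intensity N C j g h)" by simp
    also have "\<dots> \<le> move_rate N C (T_move N j g h C) j"
      unfolding move_rate_def move_intensity_def[symmetric]
      using m by (intro sum_mono2) (auto intro: move_intensity_nonneg finite_subset[OF _ finite_moves[of N C j]])
    finally have "move_intensity N C j g h \<le> rate N C (T_move N j g h C)"
      using rate_move[OF C m] by simp
    moreover have "0 < move_intensity N C j g h"
      using g(3) h(3) by (simp add: move_intensity_def service_intensity_def)
    ultimately show ?thesis using move_target[OF C m] work_move[OF m] by force
  qed
qed

sublocale drift_chain "states N" "rate N" "work N" max_jump mean_work_input "\<lambda>_. []"
proof
  fix C D :: "('i, 'j) state" assume C: "C \<in> states N"
  show "rate N C C = 0" using rate_work[of C C] by blast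
  show "(\<Sum>y | y \<in> states N \<and> work N y \<le> work N C + max_jump.
      rate N C y * (real (work N y) - real (work N C))) \<le> mean_work_input"
    using work_drift[OF C] by (simp add: reach_def)
  show "C \<noteq> (\<lambda>_. []) \<Longrightarrow> \<exists>y\<in>states N. 0 < rate N C y \<and> work N y < work N C"
    by (rule work_descends[OF C])
  show "rate N C D \<noteq> 0 \<Longrightarrow> work N D \<le> work N C + max_jump \<and> work N C \<le> work N D + max_jump"
    using rate_work[of C D] by (auto simp: max_jump_def)
next
  show "0 \<le> mean_work_input"
    unfolding mean_work_input_def by (intro sum_nonneg mult_nonneg_nonneg) (auto intro: less_imp_le arrival_pos)
  show "(\<lambda>_. []) \<in> states N" by (simp add: states_def)
qed (auto simp: rate_nonneg finite_work_level)

lemma weight_invariant: "invariant (weight N)"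
  unfolding invariant_def
proof
  fix D assume D: "D \<in> states N"
  have "exit_rate D = exit_total D"
    unfolding exit_rate_def near_def using targets_reach[OF D] finite_reach
    by (intro outflow[OF D]) (auto simp: reach_def)
  moreover have "inflow (weight N) D = weight N D * exit_total D"
    unfolding inflow_def
  proof (rule global_balance[OF D finite_near near_subset])
    fix C assume "C \<in> states N" "work N C \<le> work N D + 1"
    then show "C \<in> near D" unfolding near_def by (simp add: max_jump_def)
  qed
  ultimately show "inflow (weight N) D = weight N D * exit_rate D" by simp
qed

text \<open>Proportionality to the weights comes from \<open>superinvariant_unique\<close>; since the total mass
  of \<open>p\<close> is 1, the weights are summable and the constant is the reciprocal of their sum, which
  factorises over the nodes.\<close>

lemma equilibrium_imp_product:
  assumes "has_transition_rates (states N) P (rate N)" "transition_function (states N) P"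
    and eq: "equilibrium_distribution (states N) P p"
  shows "weight N summable_on states N" "\<forall>C\<in>states N. p C = product_dist N C"
proof -
  have p: "0 \<le> p C" if "C \<in> states N" for C using eq that by (simp add: equilibrium_distribution_def)
  have sum: "(p has_sum 1) (states N)" using eq by (simp add: equilibrium_distribution_def)
  have one: "weight N (\<lambda>_. []) = 1" by (simp add: weight_def node_weight_def)
  define a where "a = p (\<lambda>_. [])"
  have pa: "p C = a * weight N C" if "C \<in> states N" for C
    using superinvariant_unique[OF p has_sum_imp_summable[OF sum]
        equilibrium_superinvariant[OF assms(1) eq assms(2)] weight_nonneg[OF network] weight_invariant _ that]
    by (simp add: one a_def)
  have sum': "((\<lambda>C. a * weight N C) has_sum 1) (states N)"
    using sum by (simp add: pa cong: has_sum_cong)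
  have a: "a \<noteq> 0"
  proof
    assume "a = 0"
    then have "((\<lambda>_. 0::real) has_sum 1) (states N)" using sum' by simp
    then show False using has_sum_unique[OF _ has_sum_0] by (metis zero_neq_one)
  qed
  have "((\<lambda>C. inverse a * (a * weight N C)) has_sum inverse a * 1) (states N)"
    by (rule has_sum_cmult_right[OF sum'])
  then have w: "(weight N has_sum inverse a) (states N)" using a by (simp add: mult.assoc[symmetric])
  show summable: "weight N summable_on states N" by (rule has_sum_imp_summable[OF w])
  have "inverse a = (\<Prod>j\<in>UNIV. \<Sum>n. norm_term N j n)"
    using infsum_weight[OF network summable] infsumI[OF w] by simp
  then have "inverse (inverse a) = (\<Prod>j\<in>UNIV. norm_const N j)"
    by (simp only: norm_const_def prod_inversef[symmetric] o_def)
  then have "a = (\<Prod>j\<in>UNIV. norm_const N j)" by simp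
  then show "\<forall>C\<in>states N. p C = product_dist N C" by (simp add: pa product_dist_eq)
qed

end

section \<open>The equilibrium distribution\<close>

theorem theorem2p1:
  fixes N :: "('i::finite, 'j::finite) network"
    and M :: "'w measure"
    and X :: "real \<Rightarrow> 'w \<Rightarrow> ('i, 'j) state"
    and P :: "real \<Rightarrow> ('i, 'j) state \<Rightarrow> ('i, 'j) state \<Rightarrow> real"
  assumes network: "open_network N"
    and total_rate: "\<And>j n. n \<ge> 1 \<Longrightarrow>
      (\<Sum>l=1..n. service_rate N j l * velocity N j n l) = service_rate N j n"
    and chain: "markov_chain M X (states N) P"
    and rates: "has_transition_rates (states N) P (rate N)"
    and stationary: "stationary_process M X"
  shows "(\<forall>j. summable (norm_term N j)) \<and>
    (\<forall>p. equilibrium_distribution (states N) P p \<longleftrightarrow>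
       (\<forall>C\<in>states N. p C = product_dist N C)) \<and>
    (\<forall>t\<ge>0. \<forall>C\<in>states N. \<P>(\<omega> in M. X t \<omega> = C) = product_dist N C)"
proof -
  interpret balanced_network N by unfold_locales (use network total_rate in auto)
  have tf: "transition_function (states N) P" using chain by (simp add: markov_chain_def)
  note unique = equilibrium_imp_product[OF rates tf]
  have law: "equilibrium_distribution (states N) P (\<lambda>C. \<P>(\<omega> in M. X 0 \<omega> = C))"
    by (rule marginal_equilibrium[OF chain stationary])
  have eq: "equilibrium_distribution (states N) P p" if p: "\<forall>C\<in>states N. p C = product_dist N C" for p
  proof (subst equilibrium_cong)
    show "p C = \<P>(\<omega> in M. X 0 \<omega> = C)" if "C \<in> states N" for C
      using bspec[OF p that] bspec[OF unique(2)[OF law] that] by (rule trans[OF _ sym])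
  qed (rule law)
  show ?thesis
  proof (intro conjI allI impI)
    show "summable (norm_term N j)" for j
      by (rule norm_term_summable[OF network unique(1)[OF law]])
    show "equilibrium_distribution (states N) P p \<longleftrightarrow> (\<forall>C\<in>states N. p C = product_dist N C)" for p
      using unique(2)[of p] eq[of p] by blast
    show "\<forall>C\<in>states N. \<P>(\<omega> in M. X t \<omega> = C) = product_dist N C" if "0 \<le> t" for t
      unfolding stationary_marginal[OF stationary that] by (rule unique(2)[OF law])
  qed
qed

end
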